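(* Let $G=(V,E)$ be a finite, strongly connected directed multigraph (loops and multiple edges allowed), with $n=\#V$. The following are equivalent. \begin{enumerate} \item $\mathrm{Im}(\Delta:\mathbb{Z}^V\to\mathbb{Z}^V)=\mathbb{Z}^V_0$. \item $M_G=1$. \item A chip configuration $\sigma\in\mathbb{Z}^V$ on $G$ stabilizes if and only if $|\sigma|\le \#E-\#V$. \item For all $s\in V$, the sandpile group $K(G,s)$ is cyclic with generator $\overline{\beta_s}$. \item For some $s\in V$, the sandpile group $K(G,s)$ is cyclic with generator $\overline{\beta_s}$. \end{enumerate}
   Context: For $v,w\in V$, $d_{vw}$ is the number of directed edges from $v$ to $w$, and $d_v$ is the outdegree of $v$. The graph Laplacian $\Delta:\mathbb{Z}^V\to\mathbb{Z}^V$ is $\Delta f(v)=d_v f(v)-\sum_{e:\,\mathrm{head}(e)=v} f(\mathrm{tail}(e))$; as a matrix, $\Delta_{vw}=-d_{wv}$ for $v\ne w$ and $\Delta_{vv}=d_v-d_{vv}$. $\mathbb{Z}^V_0=\{\sigma\in\mathbb{Z}^V:\sum_v\sigma(v)=0\}$, and $|\sigma|=\sum_{v\in V}\sigma(v)$. For $v\in V$, $\kappa(v)$ is the number of oriented spanning trees rooted at $v$ (spanning subgraphs in which every vertex other than $v$ has outdegree $1$, $v$ has outdegree $0$, and there are no directed cycles). The Pham index is $M_G=\gcd\{\kappa(v):v\in V\}$. A chip configuration is any $\sigma\in\mathbb{Z}^V$. Vertex $v$ is active for $\sigma$ if $\sigma(v)\ge d_v$; firing $v$ replaces $\sigma$ by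 $\sigma-\Delta\delta_v$, where $\delta_v$ is the indicator of $v$. A configuration is stable if $\sigma(v)<d_v$ for all $v$. A legal firing sequence is a sequence $\sigma_0,\dots,\sigma_k$ in which each $\sigma_i$ is obtained from $\sigma_{i-1}$ by firing a vertex active for $\sigma_{i-1}$; $\sigma$ stabilizes if there is a legal firing sequence starting at $\sigma$ and ending at a stable configuration. For a sink $s\in V$, $\Delta_s$ is the matrix obtained from $\Delta$ by deleting the row and column of $s$, and the sandpile group is $K(G,s)=\mathbb{Z}^{V\setminus\{s\}}/\Delta_s\mathbb{Z}^{V\setminus\{s\}}$. $\beta_s\in\mathbb{Z}^{V\setminus\{s\}}$ is $\beta_s(v)=d_{sv}$, and $\overline{\beta_s}$ denotes its class in $K(G,s)$. *)

theory Defs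
  imports
    "Graph_Theory.Graph_Theory"
    "HOL-Algebra.Elementary_Groups"
    "HOL-Algebra.Product_Groups"
begin

section \<open>Integer vectors indexed by a set\<close>

text \<open>
  A directed multigraph is a \<^typ>\<open>('a, 'b) pre_digraph\<close>, which allows loops and parallel arcs.
  The elements of \<open>\<int>\<^sup>S\<close> are the extensional functions on \<open>S\<close> (equal to \<^const>\<open>undefined\<close> outside
  \<open>S\<close>), so that equality of vectors is equality of functions, and \<open>\<int>\<^sup>S\<close> is the carrier of a
  \<^const>\<open>product_group\<close>.
\<close>

definition int_vectors :: "'a set \<Rightarrow> ('a \<Rightarrow> int) set" where
  "int_vectors S = S \<rightarrow>\<^sub>E UNIV"

definition int_vectors_0 :: "'a set \<Rightarrow> ('a \<Rightarrow> int) set" where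
  "int_vectors_0 S = {\<sigma> \<in> int_vectors S. (\<Sum>v\<in>S. \<sigma> v) = 0}"

definition int_vector_group :: "'a set \<Rightarrow> ('a \<Rightarrow> int) monoid" where
  "int_vector_group S = product_group S (\<lambda>_. integer_group)"

lemma carrier_int_vector_group [simp]: "carrier (int_vector_group S) = int_vectors S"
  by (simp add: int_vector_group_def int_vectors_def integer_group_def)

lemma mult_int_vector_group [simp]:
  "x \<otimes>\<^bsub>int_vector_group S\<^esub> y = (\<lambda>v\<in>S. x v + y v)"
  by (simp add: int_vector_group_def integer_group_def)

lemma comm_group_int_vector_group: "comm_group (int_vector_group S)"
proof (rule group.group_comm_groupI)
  show "group (int_vector_group S)"
    by (simp add: int_vector_group_def)
qed (simp add: add.commute)

section \<open>The graph Laplacian\<close>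

definition arc_multiplicity :: "('a, 'b) pre_digraph \<Rightarrow> 'a \<Rightarrow> 'a \<Rightarrow> nat" where
  "arc_multiplicity G v w = card {e \<in> arcs G. tail G e = v \<and> head G e = w}"

definition laplacian :: "('a, 'b) pre_digraph \<Rightarrow> ('a \<Rightarrow> int) \<Rightarrow> ('a \<Rightarrow> int)" where
  "laplacian G f =
    (\<lambda>v\<in>verts G. int (out_degree G v) * f v - (\<Sum>e\<in>in_arcs G v. f (tail G e)))"

definition laplacian_matrix :: "('a, 'b) pre_digraph \<Rightarrow> 'a \<Rightarrow> 'a \<Rightarrow> int" where
  "laplacian_matrix G v w =
    (if v = w then int (out_degree G v) - int (arc_multiplicity G v v)
     else - int (arc_multiplicity G w v))"

lemma (in fin_digraph) laplacian_eq_matrix: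
  "laplacian G f = (\<lambda>v\<in>verts G. \<Sum>w\<in>verts G. laplacian_matrix G v w * f w)"
proof -
  have "int (out_degree G v) * f v - (\<Sum>e\<in>in_arcs G v. f (tail G e)) =
      (\<Sum>w\<in>verts G. laplacian_matrix G v w * f w)" if v: "v \<in> verts G" for v
  proof -
    have "(\<Sum>e\<in>in_arcs G v. f (tail G e)) =
        (\<Sum>w\<in>verts G. \<Sum>e | e \<in> in_arcs G v \<and> tail G e = w. f (tail G e))"
      by (rule sum.group[symmetric]) auto
    also have "\<dots> = (\<Sum>w\<in>verts G. int (arc_multiplicity G w v) * f w)"
    proof (rule sum.cong[OF refl])
      fix w
      have "{e \<in> in_arcs G v. tail G e = w} = {e \<in> arcs G. tail G e = w \<and> head G e = v}"
        by auto
      then show "(\<Sum>e | e \<in> in_arcs G v \<and> tail G e = w. f (tail G e)) =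
          int (arc_multiplicity G w v) * f w"
        by (simp add: arc_multiplicity_def)
    qed
    finally have 1: "(\<Sum>e\<in>in_arcs G v. f (tail G e)) =
        (\<Sum>w\<in>verts G. int (arc_multiplicity G w v) * f w)" .
    have "(\<Sum>w\<in>verts G. laplacian_matrix G v w * f w) =
        (\<Sum>w\<in>verts G. (if w = v then int (out_degree G v) * f w else 0)
          - int (arc_multiplicity G w v) * f w)"
      by (rule sum.cong) (auto simp: laplacian_matrix_def algebra_simps)
    also have "\<dots> = int (out_degree G v) * f v
        - (\<Sum>w\<in>verts G. int (arc_multiplicity G w v) * f w)"
      using v by (simp add: sum_subtractf)
    finally show ?thesis using 1 by simp
  qed
  then show ?thesis by (auto simp: laplacian_def)
qed

section \<open>Oriented spanning trees and the Pham index\<close>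

text \<open>
  A spanning subgraph has the \<^const>\<open>tail\<close> and \<^const>\<open>head\<close> functions of the ambient graph, so it
  is determined by its set of arcs and the cardinality below counts each tree once.  A loop is a
  \<^const>\<open>pre_digraph.cycle\<close>.
\<close>

definition oriented_spanning_tree ::
    "('a, 'b) pre_digraph \<Rightarrow> 'a \<Rightarrow> ('a, 'b) pre_digraph \<Rightarrow> bool" where
  "oriented_spanning_tree G r T \<longleftrightarrow>
    spanning T G \<and>
    (\<forall>v\<in>verts G - {r}. out_degree T v = 1) \<and>
    out_degree T r = 0 \<and>
    (\<nexists>p. pre_digraph.cycle T p)"

definition spanning_tree_count :: "('a, 'b) pre_digraph \<Rightarrow> 'a \<Rightarrow> nat" where
  "spanning_tree_count G r = card {T. oriented_spanning_tree G r T}"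

definition Pham_index :: "('a, 'b) pre_digraph \<Rightarrow> nat" where
  "Pham_index G = Gcd (spanning_tree_count G ` verts G)"

section \<open>Chip-firing\<close>

definition fire :: "('a, 'b) pre_digraph \<Rightarrow> 'a \<Rightarrow> ('a \<Rightarrow> int) \<Rightarrow> ('a \<Rightarrow> int)" where
  "fire G v \<sigma> = (\<lambda>w\<in>verts G. \<sigma> w - laplacian G (\<lambda>u\<in>verts G. if u = v then 1 else 0) w)"

definition active :: "('a, 'b) pre_digraph \<Rightarrow> ('a \<Rightarrow> int) \<Rightarrow> 'a \<Rightarrow> bool" where
  "active G \<sigma> v \<longleftrightarrow> v \<in> verts G \<and> \<sigma> v \<ge> int (out_degree G v)"

definition stable :: "('a, 'b) pre_digraph \<Rightarrow> ('a \<Rightarrow> int) \<Rightarrow> bool" where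
  "stable G \<sigma> \<longleftrightarrow> (\<forall>v\<in>verts G. \<sigma> v < int (out_degree G v))"

definition legal_firing_sequence :: "('a, 'b) pre_digraph \<Rightarrow> ('a \<Rightarrow> int) list \<Rightarrow> bool" where
  "legal_firing_sequence G \<sigma>s \<longleftrightarrow>
    \<sigma>s \<noteq> [] \<and> set \<sigma>s \<subseteq> int_vectors (verts G) \<and>
    (\<forall>i. Suc i < length \<sigma>s \<longrightarrow> (\<exists>v. active G (\<sigma>s ! i) v \<and> \<sigma>s ! Suc i = fire G v (\<sigma>s ! i)))"

definition stabilizes :: "('a, 'b) pre_digraph \<Rightarrow> ('a \<Rightarrow> int) \<Rightarrow> bool" where
  "stabilizes G \<sigma> \<longleftrightarrow>
    (\<exists>\<sigma>s. legal_firing_sequence G \<sigma>s \<and> hd \<sigma>s = \<sigma> \<and> stable G (last \<sigma>s))"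

section \<open>Sandpile groups\<close>

definition reduced_laplacian ::
    "('a, 'b) pre_digraph \<Rightarrow> 'a \<Rightarrow> ('a \<Rightarrow> int) \<Rightarrow> ('a \<Rightarrow> int)" where
  "reduced_laplacian G s f =
    (\<lambda>v\<in>verts G - {s}. \<Sum>w\<in>verts G - {s}. laplacian_matrix G v w * f w)"

definition reduced_laplacian_image :: "('a, 'b) pre_digraph \<Rightarrow> 'a \<Rightarrow> ('a \<Rightarrow> int) set" where
  "reduced_laplacian_image G s = reduced_laplacian G s ` int_vectors (verts G - {s})"

definition sandpile_group :: "('a, 'b) pre_digraph \<Rightarrow> 'a \<Rightarrow> ('a \<Rightarrow> int) set monoid" where
  "sandpile_group G s = int_vector_group (verts G - {s}) Mod reduced_laplacian_image G s"

definition sandpile_class ::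
    "('a, 'b) pre_digraph \<Rightarrow> 'a \<Rightarrow> ('a \<Rightarrow> int) \<Rightarrow> ('a \<Rightarrow> int) set" where
  "sandpile_class G s x = reduced_laplacian_image G s #>\<^bsub>int_vector_group (verts G - {s})\<^esub> x"

definition sink_vector :: "('a, 'b) pre_digraph \<Rightarrow> 'a \<Rightarrow> ('a \<Rightarrow> int)" where
  "sink_vector G s = (\<lambda>v\<in>verts G - {s}. int (arc_multiplicity G s v))"

definition cyclic_generator :: "('g, 'm) monoid_scheme \<Rightarrow> 'g \<Rightarrow> bool" where
  "cyclic_generator K x \<longleftrightarrow> x \<in> carrier K \<and> subgroup_generated K {x} = K"

lemma cyclic_group_iff_generator: "cyclic_group K \<longleftrightarrow> (\<exists>x. cyclic_generator K x)"
  by (auto simp: cyclic_group_def cyclic_generator_def)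

lemma group_hom_reduced_laplacian:
  "group_hom (int_vector_group (verts G - {s})) (int_vector_group (verts G - {s}))
    (reduced_laplacian G s)"
  unfolding group_hom_def group_hom_axioms_def hom_def
  by (auto simp: comm_group_int_vector_group comm_group.axioms(2) reduced_laplacian_def
      int_vectors_def distrib_left sum.distrib fun_eq_iff cong: restrict_cong)

lemma comm_group_sandpile_group: "comm_group (sandpile_group G s)"
proof -
  interpret h: group_hom "int_vector_group (verts G - {s})" "int_vector_group (verts G - {s})"
    "reduced_laplacian G s"
    by (rule group_hom_reduced_laplacian)
  have "subgroup (reduced_laplacian_image G s) (int_vector_group (verts G - {s}))"
    using h.img_is_subgroup by (simp add: reduced_laplacian_image_def)
  then show ?thesis
    unfolding sandpile_group_def
    by (rule comm_group.abelian_FactGroup[OF comm_group_int_vector_group])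
qed

lemma sandpile_class_sink_vector_in_carrier:
  "sandpile_class G s (sink_vector G s) \<in> carrier (sandpile_group G s)"
proof -
  have "sink_vector G s \<in> int_vectors (verts G - {s})"
    by (simp add: sink_vector_def int_vectors_def)
  then show ?thesis
    by (auto simp: sandpile_class_def sandpile_group_def FactGroup_def RCOSETS_def)
qed

end

theory Submission
  imports Defs "Jordan_Normal_Form.Determinant"
begin

text \<open>
  Let \<open>L\<^sub>s\<close> be the Laplacian with column \<open>s\<close> replaced by \<open>\<delta>\<^sub>s\<close>. Each remaining column is a sum over
  the arcs leaving a vertex, so multilinearity turns \<open>det L\<^sub>s\<close> into a sum over the choices of one
  outgoing arc at every vertex other than \<open>s\<close>. Such a choice contributes 1 if every vertex is led to
  \<open>s\<close>, and 0 otherwise, since then the indicator of the vertices that are not led to \<open>s\<close> is a kernel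
  vector. Hence \<open>det L\<^sub>s = \<kappa>(s)\<close>.

  The adjugate shows that \<open>\<kappa>(s)\<close> annihilates \<open>\<int>\<^sup>V\<^sub>0 / Im \<Delta>\<close>, so \<open>Im \<Delta> = \<int>\<^sup>V\<^sub>0\<close> if the \<open>\<kappa>(s)\<close> have gcd 1.
  Conversely let \<open>\<pi>\<close> be the positive kernel vector of \<open>\<Delta>\<close> with coprime entries. If \<open>Im \<Delta> = \<int>\<^sup>V\<^sub>0\<close> then
  \<open>\<pi>(s) \<int>\<^sup>V\<close> lies in the image of \<open>L\<^sub>s\<close>, so \<open>\<kappa>(s)\<close> divides a power of \<open>\<pi>(s)\<close>, and no prime divides all
  the \<open>\<kappa>(s)\<close>.

  Surjectivity onto \<open>\<int>\<^sup>V\<^sub>0\<close> makes every \<open>\<sigma>\<close> with at most \<open>#E - #V\<close> chips equivalent to a stable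
  configuration, by a firing vector that can be taken nonnegative after adding multiples of \<open>\<pi>\<close>; by
  the least action principle \<open>\<sigma>\<close> then stabilizes.
\<close>

section \<open>The Laplacian as a map onto the vectors of sum zero\<close>

lemma (in fin_digraph) laplacian_apply:
  "v \<in> verts G \<Longrightarrow>
    laplacian G f v = int (out_degree G v) * f v - (\<Sum>e\<in>in_arcs G v. f (tail G e))"
  by (simp add: laplacian_def)

lemma (in fin_digraph) sum_in_arcs_verts:
  fixes g :: "'b \<Rightarrow> int"
  shows "(\<Sum>v\<in>verts G. \<Sum>e\<in>in_arcs G v. g e) = (\<Sum>e\<in>arcs G. g e)"
  unfolding in_arcs_def by (rule sum.group) auto

lemma (in fin_digraph) sum_out_arcs_verts:
  fixes g :: "'b \<Rightarrow> int"
  shows "(\<Sum>v\<in>verts G. \<Sum>e\<in>out_arcs G v. g e) = (\<Sum>e\<in>arcs G. g e)"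
  unfolding out_arcs_def by (rule sum.group) auto

lemma (in fin_digraph) sum_out_degree_mult:
  "(\<Sum>v\<in>verts G. int (out_degree G v) * f v) = (\<Sum>e\<in>arcs G. f (tail G e))"
proof -
  have "(\<Sum>v\<in>verts G. int (out_degree G v) * f v) =
      (\<Sum>v\<in>verts G. \<Sum>e\<in>out_arcs G v. f (tail G e))"
    by (rule sum.cong) (auto simp: out_degree_def)
  then show ?thesis by (simp only: sum_out_arcs_verts)
qed

lemma (in fin_digraph) sum_laplacian: "(\<Sum>v\<in>verts G. laplacian G f v) = 0"
  using sum_out_degree_mult[of f] sum_in_arcs_verts[of "\<lambda>e. f (tail G e)"]
  by (simp add: laplacian_apply sum_subtractf)

lemma (in fin_digraph) sum_out_degree: "(\<Sum>v\<in>verts G. int (out_degree G v)) = int (card (arcs G))"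
  using sum_out_degree_mult[of "\<lambda>_. 1"] by simp

lemma (in fin_digraph) laplacian_in_int_vectors: "laplacian G f \<in> int_vectors (verts G)"
  by (simp add: laplacian_def int_vectors_def)

lemma (in fin_digraph) laplacian_cong:
  assumes "\<And>v. v \<in> verts G \<Longrightarrow> f v = g v"
  shows "laplacian G f = laplacian G g"
  unfolding laplacian_eq_matrix using assms by (auto intro!: sum.cong restrict_ext)

lemma (in fin_digraph) laplacian_combination:
  assumes "v \<in> verts G"
  shows "laplacian G (\<lambda>u. a * f u + b * g u) v = a * laplacian G f v + b * laplacian G g v"
  using assms by (simp add: laplacian_apply sum.distrib sum_distrib_left algebra_simps)

text \<open>Only the values on \<open>verts G\<close> enter \<open>laplacian G f\<close>, so the
  condition on extensional vectors can be traded for a pointwise one on arbitrary functions, which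
  all later arguments use.\<close>

lemma (in fin_digraph) laplacian_image_eq_iff:
  "laplacian G ` int_vectors (verts G) = int_vectors_0 (verts G) \<longleftrightarrow>
    (\<forall>z. (\<Sum>v\<in>verts G. z v) = 0 \<longrightarrow> (\<exists>f. \<forall>v\<in>verts G. laplacian G f v = z v))"
  (is "?L \<longleftrightarrow> ?R")
proof
  assume L: ?L
  show ?R
  proof (intro allI impI)
    fix z :: "'a \<Rightarrow> int" assume "(\<Sum>v\<in>verts G. z v) = 0"
    then have "restrict z (verts G) \<in> int_vectors_0 (verts G)"
      by (simp add: int_vectors_0_def int_vectors_def)
    then obtain f where "laplacian G f = restrict z (verts G)" using L by (metis imageE)
    then show "\<exists>f. \<forall>v\<in>verts G. laplacian G f v = z v" by (metis restrict_apply')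
  qed
next
  assume R: ?R
  show ?L
  proof
    show "laplacian G ` int_vectors (verts G) \<subseteq> int_vectors_0 (verts G)"
      by (auto simp: int_vectors_0_def laplacian_in_int_vectors sum_laplacian)
    show "int_vectors_0 (verts G) \<subseteq> laplacian G ` int_vectors (verts G)"
    proof
      fix z assume z: "z \<in> int_vectors_0 (verts G)"
      then obtain f where f: "\<forall>v\<in>verts G. laplacian G f v = z v"
        using R by (auto simp: int_vectors_0_def)
      have "laplacian G (restrict f (verts G)) = laplacian G f" by (rule laplacian_cong) simp
      also have "\<dots> = z"
        using f z laplacian_in_int_vectors[of f]
        by (auto simp: int_vectors_0_def int_vectors_def intro: PiE_ext)
      finally show "z \<in> laplacian G ` int_vectors (verts G)"
        by (metis image_eqI int_vectors_def restrict_PiE_iff UNIV_I)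
    qed
  qed
qed

section \<open>Determinants of matrices indexed by a finite set\<close>

lemma det_mat_leibniz:
  fixes b :: "nat \<Rightarrow> nat \<Rightarrow> int"
  shows "det (mat n n (\<lambda>(i, j). b i j)) =
    (\<Sum>p | p permutes {0..<n}. signof p * (\<Prod>i = 0..<n. b i (p i)))"
proof -
  have "(\<Prod>i = 0..<n. mat n n (\<lambda>(i, j). b i j) $$ (i, p i)) = (\<Prod>i = 0..<n. b i (p i))"
    if "p permutes {0..<n}" for p
  proof (rule prod.cong[OF refl])
    fix i assume "i \<in> {0..<n}"
    moreover from this have "p i \<in> {0..<n}" using permutes_in_image[OF that] by blast
    ultimately show "mat n n (\<lambda>(i, j). b i j) $$ (i, p i) = b i (p i)" by simp
  qed
  then show ?thesis by (simp add: det_def'[of _ n])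
qed

text \<open>If all orbits meet \<open>s\<close>, only the identity survives in the Leibniz formula;
  otherwise the indicator of the orbits missing \<open>s\<close> is a kernel vector. Row
  \<open>s\<close> is a unit row because \<open>F s\<close> will come from an undefined
  choice.\<close>

lemma det_of_functional_graph:
  fixes vs :: "nat \<Rightarrow> 'a" and F :: "'a \<Rightarrow> 'a"
  assumes vs: "bij_betw vs {0..<n} V" and F: "\<And>v. v \<in> V - {s} \<Longrightarrow> F v \<in> V" and s: "s \<in> V"
  shows "det (mat n n (\<lambda>(i, j). of_bool (i = j) - of_bool (vs i \<noteq> s \<and> vs j = F (vs i)) :: int)) =
    of_bool (\<forall>v\<in>V. \<exists>m. (F ^^ m) v = s)"
proof (cases "\<forall>v\<in>V. \<exists>m. (F ^^ m) v = s")
  case True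
  let ?b = "\<lambda>i j. of_bool (i = j) - of_bool (vs i \<noteq> s \<and> vs j = F (vs i)) :: int"
  have id: "p = id" if p: "p permutes {0..<n}" and nz: "(\<Prod>i = 0..<n. ?b i (p i)) \<noteq> 0" for p
  proof (rule ccontr)
    assume "p \<noteq> id"
    then obtain i where i: "p i \<noteq> i" by (auto simp: fun_eq_iff)
    \<comment> \<open>A nonzero factor off the diagonal must come from the second indicator.\<close>
    have step: "vs j \<noteq> s \<and> vs (p j) = F (vs j)" if "p j \<noteq> j" for j
    proof -
      have "j \<in> {0..<n}" using p that by (metis permutes_not_in)
      then have "?b j (p j) \<noteq> 0" using nz by (auto simp del: of_bool_eq)
      then show ?thesis using that by (auto split: if_splits)
    qed
    \<comment> \<open>Injectivity of \<open>p\<close> keeps the whole orbit of \<open>i\<close>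
      moved, so the \<open>F\<close>-orbit of \<open>vs i\<close> runs along it and never meets
      \<open>s\<close>.\<close>
    have "p ((p ^^ m) i) \<noteq> (p ^^ m) i \<and> vs ((p ^^ m) i) = (F ^^ m) (vs i)" for m
    proof (induction m)
      case (Suc m)
      then show ?case using step[of "(p ^^ m) i"] permutes_inj[OF p] by (auto dest: injD)
    qed (use i in simp)
    then have "(F ^^ m) (vs i) \<noteq> s" for m using step by metis
    moreover have "i \<in> {0..<n}" using i p by (metis permutes_not_in)
    then have "vs i \<in> V" using vs by (auto simp: bij_betw_def)
    ultimately show False using True by blast
  qed
  have F_neq: "F v \<noteq> v" if "v \<in> V" "v \<noteq> s" for v
  proof
    assume "F v = v"
    then have "(F ^^ m) v = v" for m by (induction m) auto
    then show False using True that by auto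
  qed
  have diag: "?b i i = 1" if "i \<in> {0..<n}" for i
    using F_neq[of "vs i"] vs that by (auto simp: bij_betw_def)
  have "det (mat n n (\<lambda>(i, j). ?b i j)) =
      (\<Sum>p | p permutes {0..<n}. signof p * (\<Prod>i = 0..<n. ?b i (p i)))"
    by (rule det_mat_leibniz)
  also have "\<dots> = (\<Sum>p\<in>{id}. signof p * (\<Prod>i = 0..<n. ?b i (p i)))"
  proof (rule sum.mono_neutral_right)
    show "\<forall>p\<in>{p. p permutes {0..<n}} - {id}. signof p * (\<Prod>i = 0..<n. ?b i (p i)) = 0"
      using id by (metis (no_types, lifting) DiffD1 DiffD2 insertI1 mem_Collect_eq mult_zero_right)
  qed (auto simp: finite_permutations permutes_id)
  also have "\<dots> = 1"
    using diag by (simp add: sign_id prod.neutral del: of_bool_eq)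
  finally show ?thesis using True by simp
next
  case False
  define C where "C = {v \<in> V. \<forall>m. (F ^^ m) v \<noteq> s}"
  let ?B = "mat n n (\<lambda>(i, j). of_bool (i = j) - of_bool (vs i \<noteq> s \<and> vs j = F (vs i)) :: int)"
  define x where "x = vec n (\<lambda>i. of_bool (vs i \<in> C) :: int)"
  obtain c where c: "c \<in> C" using False by (auto simp: C_def)
  then obtain k where k: "k < n" "vs k = c" using vs by (force simp: C_def bij_betw_def)
  \<comment> \<open>Away from \<open>s\<close>, row \<open>i\<close> of the product with
    \<open>x\<close> is the membership of \<open>vs i\<close> in \<open>C\<close> minus that of
    \<open>F (vs i)\<close>, so this invariance makes it zero.\<close>
  have CF: "F v \<in> C \<longleftrightarrow> v \<in> C" if "v \<in> V" "v \<noteq> s" for v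
  proof -
    have "(\<forall>m. (F ^^ m) (F v) \<noteq> s) \<longleftrightarrow> (\<forall>m. (F ^^ m) v \<noteq> s)"
      using that by (metis funpow_swap1 funpow.simps(2) comp_apply funpow_0 not0_implies_Suc)
    then show ?thesis using F[of v] that by (auto simp: C_def)
  qed
  have sC: "s \<notin> C" by (auto simp: C_def intro: exI[of _ 0])
  have "?B *\<^sub>v x = 0\<^sub>v n"
  proof (rule eq_vecI)
    fix i assume i: "i < dim_vec (0\<^sub>v n :: int vec)"
    then have iV: "vs i \<in> V" using vs by (auto simp: bij_betw_def)
    have "(?B *\<^sub>v x) $ i = (\<Sum>j = 0..<n.
        (of_bool (i = j) - of_bool (vs i \<noteq> s \<and> vs j = F (vs i))) * of_bool (vs j \<in> C))"
      using i by (auto simp: scalar_prod_def x_def intro!: sum.cong)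
    also have "\<dots> = (\<Sum>j = 0..<n. of_bool (i = j) * of_bool (vs j \<in> C)) -
        (\<Sum>j = 0..<n. of_bool (vs i \<noteq> s \<and> vs j = F (vs i)) * of_bool (vs j \<in> C))"
      by (simp add: sum_subtractf left_diff_distrib)
    also have "(\<Sum>j = 0..<n. of_bool (i = j) * of_bool (vs j \<in> C) :: int) = of_bool (vs i \<in> C)"
      using i by (simp add: of_bool_def if_distrib[of "\<lambda>x. x * _"] cong: if_cong)
    also have "(\<Sum>j = 0..<n. of_bool (vs i \<noteq> s \<and> vs j = F (vs i)) * of_bool (vs j \<in> C) :: int) =
        (\<Sum>v\<in>V. of_bool (vs i \<noteq> s \<and> v = F (vs i)) * of_bool (v \<in> C))"
      using sum.reindex_bij_betw[OF vs, of "\<lambda>v. of_bool (vs i \<noteq> s \<and> v = F (vs i)) * of_bool (v \<in> C) :: int"]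
      by simp
    also have "\<dots> = of_bool (vs i \<in> C)"
    proof (cases "vs i = s")
      case False
      have "finite V" using vs bij_betw_finite by blast
      then show ?thesis using False F[of "vs i"] iV CF[OF iV False]
        by (simp add: of_bool_def if_distrib[of "\<lambda>x. x * _"] cong: if_cong)
    qed (use sC in simp)
    finally show "(?B *\<^sub>v x) $ i = 0\<^sub>v n $ i" using i by simp
  qed simp
  moreover have "x \<noteq> 0\<^sub>v n"
  proof
    assume "x = 0\<^sub>v n"
    then have "x $ k = 0" using k by simp
    then show False using k c by (simp add: x_def)
  qed
  ultimately have "det ?B = 0"
    by (intro iffD2[OF det_0_iff_vec_prod_zero[of _ n]] exI[of _ x]) (auto simp: x_def)
  then show ?thesis using False by simp
qed

text \<open>Zero column sums make the all-ones vector a kernel vector of the transpose, so the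
  determinant vanishes; over an integral domain this already yields an integer kernel
  vector.\<close>

lemma ex_kernel_vector:
  fixes a :: "'a \<Rightarrow> 'a \<Rightarrow> int"
  assumes V: "finite V" "V \<noteq> {}" and col: "\<And>w. w \<in> V \<Longrightarrow> (\<Sum>v\<in>V. a v w) = 0"
  obtains f where "\<And>v. v \<in> V \<Longrightarrow> (\<Sum>w\<in>V. a v w * f w) = 0" "\<exists>v\<in>V. f v \<noteq> 0"
proof -
  obtain vs where vs: "bij_betw vs {0..<card V} V" using ex_bij_betw_nat_finite[OF V(1)] by blast
  define n where "n = card V"
  note vs = vs[folded n_def]
  have n: "n > 0" using V by (auto simp: n_def card_gt_0_iff)
  have idx: "\<exists>i<n. vs i = v" if "v \<in> V" for v using vs that by (force simp: bij_betw_def)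
  define A where "A = mat n n (\<lambda>(i, j). a (vs i) (vs j))"
  have A: "A \<in> carrier_mat n n" by (simp add: A_def)
  let ?u = "vec n (\<lambda>_. 1 :: int)"
  have "A\<^sup>T *\<^sub>v ?u = 0\<^sub>v n"
  proof (rule eq_vecI)
    fix j assume j: "j < dim_vec (0\<^sub>v n :: int vec)"
    then have "(A\<^sup>T *\<^sub>v ?u) $ j = (\<Sum>i = 0..<n. a (vs i) (vs j))"
      by (auto simp: A_def scalar_prod_def intro!: sum.cong)
    also have "\<dots> = (\<Sum>v\<in>V. a v (vs j))" by (rule sum.reindex_bij_betw[OF vs])
    also have "\<dots> = 0" using col vs j by (auto simp: bij_betw_def)
    finally show "(A\<^sup>T *\<^sub>v ?u) $ j = 0\<^sub>v n $ j" using j by simp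
  qed (simp add: A_def)
  moreover have "?u \<noteq> 0\<^sub>v n" using n by (metis index_vec index_zero_vec(1) zero_neq_one)
  ultimately have "det A\<^sup>T = 0"
    using A by (intro iffD2[OF det_0_iff_vec_prod_zero[of _ n]] exI[of _ ?u]) auto
  then have "det A = 0" by (simp add: det_transpose[OF A])
  then obtain x where x: "x \<in> carrier_vec n" "x \<noteq> 0\<^sub>v n" "A *\<^sub>v x = 0\<^sub>v n"
    using det_0_iff_vec_prod_zero[OF A] by auto
  define f where "f v = x $ (inv_into {0..<n} vs v)" for v
  have f: "f (vs i) = x $ i" if "i < n" for i
    using vs that by (simp add: f_def bij_betw_def inv_into_f_f)
  show ?thesis
  proof (rule that)
    fix v assume "v \<in> V"
    then obtain i where i: "i < n" "vs i = v" using idx by blast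
    have "(\<Sum>w\<in>V. a v w * f w) = (\<Sum>j = 0..<n. a v (vs j) * f (vs j))"
      by (rule sum.reindex_bij_betw[OF vs, symmetric])
    also have "\<dots> = (A *\<^sub>v x) $ i"
      using i x(1) by (auto simp: A_def scalar_prod_def f intro!: sum.cong)
    finally show "(\<Sum>w\<in>V. a v w * f w) = 0" using x(3) i by simp
  next
    obtain i where "i < n" "x $ i \<noteq> 0" using x(1,2) by (metis carrier_vecD eq_vecI index_zero_vec)
    then show "\<exists>v\<in>V. f v \<noteq> 0" using f vs by (auto simp: bij_betw_def intro!: bexI[of _ "vs i"])
  qed
qed

text \<open>Cramer's rule without division: the solution is the adjugate applied to
  \<open>z\<close>.\<close>

lemma ex_solution_det_multiple:
  fixes a :: "'a \<Rightarrow> 'a \<Rightarrow> int"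
  assumes vs: "bij_betw vs {0..<n} V"
  shows "\<exists>f. \<forall>v\<in>V. (\<Sum>w\<in>V. a v w * f w) = det (mat n n (\<lambda>(i, j). a (vs i) (vs j))) * z v"
proof -
  define A where "A = mat n n (\<lambda>(i, j). a (vs i) (vs j))"
  have A: "A \<in> carrier_mat n n" by (simp add: A_def)
  define y where "y = vec n (\<lambda>i. z (vs i))"
  have y: "y \<in> carrier_vec n" by (simp add: y_def)
  define x where "x = adj_mat A *\<^sub>v y"
  have x: "x \<in> carrier_vec n" using adj_mat(1)[OF A] y by (simp add: x_def)
  have "A *\<^sub>v x = (A * adj_mat A) *\<^sub>v y"
    using assoc_mult_mat_vec[OF A adj_mat(1)[OF A] y] by (simp add: x_def)
  also have "\<dots> = det A \<cdot>\<^sub>v y"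
    using y by (intro eq_vecI)
      (auto simp: adj_mat(2)[OF A] scalar_prod_def mult.assoc if_distrib[of "\<lambda>x. x * _"]
        simp flip: sum_distrib_left cong: if_cong)
  finally have Ax: "A *\<^sub>v x = det A \<cdot>\<^sub>v y" .
  define f where "f v = x $ (inv_into {0..<n} vs v)" for v
  have f: "f (vs i) = x $ i" if "i < n" for i
    using vs that by (simp add: f_def bij_betw_def inv_into_f_f)
  have "(\<Sum>w\<in>V. a v w * f w) = det A * z v" if v: "v \<in> V" for v
  proof -
    obtain i where i: "i < n" "vs i = v" using vs v by (force simp: bij_betw_def)
    have "(\<Sum>w\<in>V. a v w * f w) = (\<Sum>j = 0..<n. a v (vs j) * f (vs j))"
      by (rule sum.reindex_bij_betw[OF vs, symmetric])
    also have "\<dots> = (A *\<^sub>v x) $ i"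
      using i x(1) by (auto simp: A_def scalar_prod_def f intro!: sum.cong)
    finally show ?thesis using Ax i y by (simp add: y_def)
  qed
  then show ?thesis by (auto simp: A_def)
qed

text \<open>The solutions are the columns of an integer matrix \<open>Y\<close> with
  \<open>A * Y\<close> equal to \<open>c\<close> times the identity; take determinants.\<close>

lemma det_dvd_power:
  fixes a :: "'a \<Rightarrow> 'a \<Rightarrow> int"
  assumes vs: "bij_betw vs {0..<n} V"
    and sol: "\<And>u. u \<in> V \<Longrightarrow> \<exists>f. \<forall>v\<in>V. (\<Sum>w\<in>V. a v w * f w) = c * of_bool (v = u)"
  shows "det (mat n n (\<lambda>(i, j). a (vs i) (vs j))) dvd c ^ n"
proof -
  define A where "A = mat n n (\<lambda>(i, j). a (vs i) (vs j))"
  have A: "A \<in> carrier_mat n n" by (simp add: A_def)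
  obtain F where F: "\<And>u v. u \<in> V \<Longrightarrow> v \<in> V \<Longrightarrow> (\<Sum>w\<in>V. a v w * F u w) = c * of_bool (v = u)"
    using sol by metis
  define Y where "Y = mat n n (\<lambda>(i, j). F (vs j) (vs i))"
  have Y: "Y \<in> carrier_mat n n" by (simp add: Y_def)
  have vsV: "vs i \<in> V" if "i < n" for i using vs that by (auto simp: bij_betw_def)
  have eq: "vs i = vs j \<longleftrightarrow> i = j" if "i < n" "j < n" for i j
    using vs that by (auto simp: bij_betw_def inj_on_def)
  have "A * Y = c \<cdot>\<^sub>m 1\<^sub>m n"
  proof (rule eq_matI)
    fix i j assume "i < dim_row (c \<cdot>\<^sub>m 1\<^sub>m n)" "j < dim_col (c \<cdot>\<^sub>m 1\<^sub>m n)"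
    then have ij: "i < n" "j < n" by auto
    have "(A * Y) $$ (i, j) = (\<Sum>k = 0..<n. a (vs i) (vs k) * F (vs j) (vs k))"
      using ij by (auto simp: A_def Y_def scalar_prod_def intro!: sum.cong)
    also have "\<dots> = (\<Sum>w\<in>V. a (vs i) w * F (vs j) w)" by (rule sum.reindex_bij_betw[OF vs])
    also have "\<dots> = c * of_bool (i = j)" using F vsV ij eq by simp
    finally show "(A * Y) $$ (i, j) = (c \<cdot>\<^sub>m 1\<^sub>m n) $$ (i, j)" using ij by simp
  qed (simp_all add: A_def Y_def)
  then have "det A * det Y = c ^ n" using det_mult[OF A Y] by (simp add: det_smult)
  then show ?thesis unfolding A_def by (metis dvd_triv_left)
qed

section \<open>The matrix-tree theorem\<close>

text \<open>The form to which multilinearity applies: one summand per arc leaving \<open>w\<close>,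
  where a loop cancels itself.\<close>

lemma (in fin_digraph) laplacian_matrix_eq_sum_out_arcs:
  "laplacian_matrix G v w =
    (\<Sum>e\<in>out_arcs G w. of_bool (v = w) - of_bool (v = head G e))"
proof -
  have "(\<Sum>e\<in>out_arcs G w. of_bool (v = head G e) :: int) =
      int (card {e \<in> out_arcs G w. v = head G e})"
    by (simp add: of_bool_def finite_out_arcs flip: sum.inter_filter del: in_out_arcs_conv)
  also have "{e \<in> out_arcs G w. v = head G e} = {e \<in> arcs G. tail G e = w \<and> head G e = v}"
    by auto
  finally show ?thesis
    by (auto simp: laplacian_matrix_def arc_multiplicity_def out_degree_def sum_subtractf)
qed

text \<open>
  Expanding along column \<open>s\<close> shows that this matrix has the determinant of the reduced Laplacian;
  keeping all of \<open>V\<close> as index set allows one enumeration of \<open>V\<close> to serve every sink.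
\<close>

definition sink_matrix :: "('a, 'b) pre_digraph \<Rightarrow> 'a \<Rightarrow> 'a \<Rightarrow> 'a \<Rightarrow> int" where
  "sink_matrix G s v w = (if w = s then of_bool (v = s) else laplacian_matrix G v w)"

text \<open>Expanding the product of column sums gives one summand per choice \<open>c\<close> of
  outgoing arcs. Exchanging this sum with that over permutations leaves, for each \<open>c\<close>,
  the determinant of a functional graph.\<close>

lemma (in fin_digraph) det_sink_matrix_eq_card:
  assumes vs: "bij_betw vs {0..<n} (verts G)" and s: "s \<in> verts G"
  shows "det (mat n n (\<lambda>(i, j). sink_matrix G s (vs i) (vs j))) =
    int (card {c \<in> PiE (verts G - {s}) (out_arcs G).
      \<forall>v\<in>verts G. \<exists>m. ((\<lambda>v. head G (c v)) ^^ m) v = s})"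
proof -
  let ?C = "PiE (verts G - {s}) (out_arcs G)"
  let ?M = "mat n n (\<lambda>(i, j). sink_matrix G s (vs i) (vs j))"
  let ?b = "\<lambda>c i j. of_bool (i = j) - of_bool (vs i \<noteq> s \<and> vs j = head G (c (vs i))) :: int"
  define idx where "idx = inv_into {0..<n} vs"
  have idx: "idx v < n" "vs (idx v) = v" if "v \<in> verts G" for v
    using bij_betwE[OF bij_betw_inv_into[OF vs]] bij_betw_inv_into_right[OF vs] that
    by (auto simp: idx_def)
  have eq: "vs i = vs j \<longleftrightarrow> i = j" if "i < n" "j < n" for i j
    using vs that by (auto simp: bij_betw_def inj_on_def)
  \<comment> \<open>The transpose makes factor \<open>i\<close> an entry of column
    \<open>vs i\<close>, hence a sum over the arcs leaving one vertex, or an entry of the unit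
    column \<open>s\<close>.\<close>
  have expand: "(\<Prod>i = 0..<n. ?M\<^sup>T $$ (i, p i)) = (\<Sum>c\<in>?C. \<Prod>i = 0..<n. ?b c i (p i))"
    if p: "p permutes {0..<n}" for p
  proof -
    have pn: "p i < n" if "i < n" for i using p that by (metis atLeastLessThan_iff permutes_in_image zero_le)
    let ?q = "\<lambda>v. vs (p (idx v))"
    have "(\<Prod>i = 0..<n. ?M\<^sup>T $$ (i, p i)) = (\<Prod>i = 0..<n. sink_matrix G s (?q (vs i)) (vs i))"
      using pn vs by (intro prod.cong) (auto simp: idx_def bij_betw_def inv_into_f_f)
    also have "\<dots> = (\<Prod>v\<in>verts G. sink_matrix G s (?q v) v)"
      by (rule prod.reindex_bij_betw[OF vs])
    also have "\<dots> = of_bool (?q s = s) *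
        (\<Prod>v\<in>verts G - {s}. \<Sum>e\<in>out_arcs G v. of_bool (?q v = v) - of_bool (?q v = head G e))"
      unfolding prod.remove[OF finite_verts s]
      by (intro arg_cong2[of _ _ _ _ "(*)"] prod.cong)
        (simp_all add: sink_matrix_def laplacian_matrix_eq_sum_out_arcs)
    also have "\<dots> = of_bool (?q s = s) *
        (\<Sum>c\<in>?C. \<Prod>v\<in>verts G - {s}. of_bool (?q v = v) - of_bool (?q v = head G (c v)))"
      by (simp add: prod_sum_PiE finite_out_arcs)
    \<comment> \<open>The factor of the sink returns under the product; the guard
      \<open>v \<noteq> s\<close> masks the undefined value of \<open>c\<close> at
      \<open>s\<close>.\<close>
    also have "\<dots> = (\<Sum>c\<in>?C. \<Prod>v\<in>verts G.
        of_bool (?q v = v) - of_bool (v \<noteq> s \<and> ?q v = head G (c v)))"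
    proof -
      have "(\<Prod>v\<in>verts G. of_bool (?q v = v) - of_bool (v \<noteq> s \<and> ?q v = head G (c v)) :: int) =
          of_bool (?q s = s) *
            (\<Prod>v\<in>verts G - {s}. of_bool (?q v = v) - of_bool (?q v = head G (c v)))" for c
        unfolding prod.remove[OF finite_verts s]
        by (intro arg_cong2[of _ _ _ _ "(*)"] prod.cong) auto
      then show ?thesis by (simp only: sum_distrib_left)
    qed
    also have "\<dots> = (\<Sum>c\<in>?C. \<Prod>i = 0..<n. ?b c i (p i))"
    proof (rule sum.cong[OF refl])
      fix c
      have "(\<Prod>v\<in>verts G. of_bool (?q v = v) - of_bool (v \<noteq> s \<and> ?q v = head G (c v)) :: int) =
          (\<Prod>i = 0..<n. of_bool (?q (vs i) = vs i) -
            of_bool (vs i \<noteq> s \<and> ?q (vs i) = head G (c (vs i))))"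
        by (rule prod.reindex_bij_betw[OF vs, symmetric])
      also have "\<dots> = (\<Prod>i = 0..<n. ?b c i (p i))"
      proof (rule prod.cong[OF refl])
        fix i assume "i \<in> {0..<n}"
        then have "idx (vs i) = i" "vs (p i) = vs i \<longleftrightarrow> i = p i"
          using vs eq pn by (auto simp: idx_def bij_betw_def inv_into_f_f)
        then show "of_bool (?q (vs i) = vs i) -
            of_bool (vs i \<noteq> s \<and> ?q (vs i) = head G (c (vs i))) = ?b c i (p i)"
          by (simp del: of_bool_eq)
      qed
      finally show "(\<Prod>v\<in>verts G. of_bool (?q v = v) - of_bool (v \<noteq> s \<and> ?q v = head G (c v))) =
          (\<Prod>i = 0..<n. ?b c i (p i))" .
    qed
    finally show ?thesis .
  qed
  have M: "?M \<in> carrier_mat n n" by simp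
  have "det ?M = det (?M\<^sup>T)" by (rule det_transpose[OF M, symmetric])
  also have "\<dots> = (\<Sum>p | p permutes {0..<n}. signof p * (\<Prod>i = 0..<n. ?M\<^sup>T $$ (i, p i)))"
    by (rule det_def') simp
  also have "\<dots> = (\<Sum>p | p permutes {0..<n}. \<Sum>c\<in>?C. signof p * (\<Prod>i = 0..<n. ?b c i (p i)))"
    by (intro sum.cong) (simp_all only: expand mem_Collect_eq sum_distrib_left)
  also have "\<dots> = (\<Sum>c\<in>?C. \<Sum>p | p permutes {0..<n}. signof p * (\<Prod>i = 0..<n. ?b c i (p i)))"
    by (rule sum.swap)
  also have "\<dots> = (\<Sum>c\<in>?C. det (mat n n (\<lambda>(i, j). ?b c i j)))"
    by (simp only: det_mat_leibniz)
  also have "\<dots> = (\<Sum>c\<in>?C. of_bool (\<forall>v\<in>verts G. \<exists>m. ((\<lambda>v. head G (c v)) ^^ m) v = s))"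
  proof (rule sum.cong[OF refl])
    fix c assume c: "c \<in> ?C"
    have "head G (c v) \<in> verts G" if "v \<in> verts G - {s}" for v using PiE_mem[OF c that] by auto
    then show "det (mat n n (\<lambda>(i, j). ?b c i j)) =
        of_bool (\<forall>v\<in>verts G. \<exists>m. ((\<lambda>v. head G (c v)) ^^ m) v = s)"
      by (rule det_of_functional_graph[OF vs _ s])
  qed
  also have "\<dots> = int (card {c \<in> ?C. \<forall>v\<in>verts G. \<exists>m. ((\<lambda>v. head G (c v)) ^^ m) v = s})"
  proof -
    have "finite ?C" by (rule finite_PiE) auto
    then show ?thesis by (simp add: of_bool_def sum.If_cases Int_def)
  qed
  finally show ?thesis .
qed

text \<open>For a nonempty closed walk, where \<open>w\<close> is itself a tail, the set of tails
  thus contains all heads.\<close>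

lemma (in pre_digraph) head_in_tails_of_cas:
  "cas u p w \<Longrightarrow> e \<in> set p \<Longrightarrow> head G e = w \<or> head G e \<in> tail G ` set p"
proof (induction p arbitrary: u)
  case (Cons e' es)
  then show ?case by (cases es) auto
qed simp

text \<open>With \<open>tail\<close> and \<open>head\<close> copied from \<open>G\<close>, an
  oriented spanning tree is equal as a record to the graph of its choice of arcs.\<close>

definition choice_graph :: "('a, 'b) pre_digraph \<Rightarrow> 'a \<Rightarrow> ('a \<Rightarrow> 'b) \<Rightarrow> ('a, 'b) pre_digraph" where
  "choice_graph G s c =
    \<lparr>verts = verts G, arcs = c ` (verts G - {s}), tail = tail G, head = head G\<rparr>"

lemma choice_graph_simps [simp]:
  "verts (choice_graph G s c) = verts G"
  "arcs (choice_graph G s c) = c ` (verts G - {s})"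
  "tail (choice_graph G s c) = tail G"
  "head (choice_graph G s c) = head G"
  by (simp_all add: choice_graph_def)

section \<open>Oriented spanning trees as choices of outgoing arcs\<close>

context fin_digraph
begin

context
  fixes s c
  assumes s: "s \<in> verts G" and c: "c \<in> PiE (verts G - {s}) (out_arcs G)"
begin

lemma choice_arc:
  assumes "v \<in> verts G" "v \<noteq> s"
  shows "c v \<in> arcs G" "tail G (c v) = v"
  using PiE_mem[OF c, of v] assms by auto

lemma wf_choice_graph: "wf_digraph (choice_graph G s c)"
  by unfold_locales (use choice_arc in fastforce)+

lemma spanning_choice_graph: "spanning (choice_graph G s c) G"
  using wf_choice_graph wf_digraph_axioms choice_arc(1)
  by (auto simp: spanning_def subgraph_def compatible_def)

lemma out_arcs_choice_graph:
  "out_arcs (choice_graph G s c) v = (if v \<in> verts G - {s} then {c v} else {})"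
proof (rule Set.set_eqI)
  fix e
  have "e \<in> c ` (verts G - {s}) \<and> tail G e = v \<longleftrightarrow> v \<in> verts G - {s} \<and> e = c v"
  proof
    assume "e \<in> c ` (verts G - {s}) \<and> tail G e = v"
    then obtain w where "w \<in> verts G - {s}" "e = c w" "tail G e = v" by blast
    then show "v \<in> verts G - {s} \<and> e = c v" using choice_arc(2)[of w] by simp
  next
    assume "v \<in> verts G - {s} \<and> e = c v"
    then show "e \<in> c ` (verts G - {s}) \<and> tail G e = v" using choice_arc(2)[of v] by simp
  qed
  then show "e \<in> out_arcs (choice_graph G s c) v \<longleftrightarrow>
      e \<in> (if v \<in> verts G - {s} then {c v} else {})"
    by (simp add: out_arcs_def)
qed

text \<open>An orbit that avoids \<open>s\<close> stays in the finite set \<open>verts G\<close>,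
  hence repeats; the stretch between two equal positions is a closed walk of positive length and
  contains a cycle.\<close>

lemma reaches_if_acyclic_choice_graph:
  assumes "\<nexists>p. pre_digraph.cycle (choice_graph G s c) p" and v: "v \<in> verts G"
  shows "\<exists>m. ((\<lambda>v. head G (c v)) ^^ m) v = s"
proof (rule ccontr)
  let ?F = "\<lambda>v. head G (c v)"
  interpret T: wf_digraph "choice_graph G s c" by (rule wf_choice_graph)
  assume "\<not> ?thesis"
  then have ns: "(?F ^^ m) v \<noteq> s" for m by blast
  have inV: "(?F ^^ m) v \<in> verts G" for m
    by (induction m) (use v ns choice_arc in auto)
  have "\<not> inj (\<lambda>m. (?F ^^ m) v)"
    using inV finite_verts by (metis finite_subset image_subsetI range_inj_infinite)
  then obtain i j where ij: "i < j" "(?F ^^ i) v = (?F ^^ j) v"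
    by (metis (mono_tags, lifting) injI linorder_neqE_nat)
  have walk: "\<exists>p. T.awalk ((?F ^^ i) v) p ((?F ^^ (i + k)) v) \<and> length p = k" for k
  proof (induction k)
    case 0
    have "T.awalk ((?F ^^ i) v) [] ((?F ^^ i) v)"
      using inV by (simp add: T.awalk_Nil_iff)
    then show ?case by auto
  next
    case (Suc k)
    then obtain p where p: "T.awalk ((?F ^^ i) v) p ((?F ^^ (i + k)) v)" "length p = k" by blast
    let ?w = "(?F ^^ (i + k)) v"
    have "T.awalk ?w [c ?w] (?F ?w)"
      using inV[of "i + k"] ns[of "i + k"] choice_arc[of ?w]
      by (auto simp: T.awalk_def pre_digraph.cas.simps)
    then have "T.awalk ((?F ^^ i) v) (p @ [c ?w]) (?F ?w)" using p T.awalk_appendI by blast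
    then show ?case using p by (intro exI[of _ "p @ [c ?w]"]) auto
  qed
  obtain p where "T.awalk ((?F ^^ i) v) p ((?F ^^ i) v)" "length p = j - i"
    using walk[of "j - i"] ij by auto
  then have "T.closed_w p" using ij by (auto simp: T.closed_w_def)
  then show False using T.closed_w_imp_cycle assms by blast
qed

text \<open>The tails of a cycle are closed under following the chosen arcs and exclude
  \<open>s\<close>, which has no outgoing arc; an orbit started there never reaches
  \<open>s\<close>.\<close>

lemma acyclic_choice_graph_if_reaches:
  assumes "\<forall>v\<in>verts G. \<exists>m. ((\<lambda>v. head G (c v)) ^^ m) v = s"
  shows "\<not> pre_digraph.cycle (choice_graph G s c) p"
proof
  let ?F = "\<lambda>v. head G (c v)"
  interpret T: wf_digraph "choice_graph G s c" by (rule wf_choice_graph)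
  assume "T.cycle p"
  then obtain u where u: "T.awalk u p u" "p \<noteq> []" by (auto simp: T.cycle_def)
  let ?S = "tail G ` set p"
  have p: "set p \<subseteq> c ` (verts G - {s})" and cas: "T.cas u p u"
    using u unfolding T.awalk_def by auto
  have uS: "u \<in> ?S" using u(2) cas by (cases p) auto
  have step: "?F v \<in> ?S" if "v \<in> ?S" for v
  proof -
    obtain e where e: "e \<in> set p" "v = tail G e" using \<open>v \<in> ?S\<close> by blast
    moreover obtain w where "w \<in> verts G - {s}" "e = c w" using p e by blast
    ultimately have "c v = e" using choice_arc(2)[of w] by simp
    then show ?thesis using T.head_in_tails_of_cas[OF cas e(1)] uS by auto
  qed
  have "(?F ^^ m) u \<in> ?S" for m by (induction m) (use uS step in auto)
  moreover have "?S \<subseteq> verts G - {s}"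
  proof (rule image_subsetI)
    fix e assume "e \<in> set p"
    then obtain w where "w \<in> verts G - {s}" "e = c w" using p by blast
    then show "tail G e \<in> verts G - {s}" using choice_arc(2)[of w] by simp
  qed
  moreover obtain m where "(?F ^^ m) u = s"
    using assms uS \<open>?S \<subseteq> verts G - {s}\<close> by blast
  ultimately show False by blast
qed

lemma oriented_spanning_tree_choice_graph_iff:
  "oriented_spanning_tree G s (choice_graph G s c) \<longleftrightarrow>
    (\<forall>v\<in>verts G. \<exists>m. ((\<lambda>v. head G (c v)) ^^ m) v = s)"
proof -
  have "oriented_spanning_tree G s (choice_graph G s c) \<longleftrightarrow>
      (\<nexists>p. pre_digraph.cycle (choice_graph G s c) p)"
    using spanning_choice_graph
    by (simp add: oriented_spanning_tree_def out_degree_def out_arcs_choice_graph)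
  then show ?thesis
    using reaches_if_acyclic_choice_graph acyclic_choice_graph_if_reaches by blast
qed

end

lemma oriented_spanning_tree_imp_choice_graph:
  assumes s: "s \<in> verts G" and T: "oriented_spanning_tree G s T"
  obtains c where "c \<in> PiE (verts G - {s}) (out_arcs G)" "T = choice_graph G s c"
proof -
  have verts: "verts T = verts G" and arcs: "arcs T \<subseteq> arcs G" and tail: "tail T = tail G"
    and head: "head T = head G"
    using T by (auto simp: oriented_spanning_tree_def spanning_def subgraph_def compatible_def)
  \<comment> \<open>Needed to turn outdegree 0 into an empty arc set, since \<open>card\<close> of
    an infinite set is 0 as well.\<close>
  have fin: "finite (out_arcs T v)" for v
    by (rule finite_subset[OF _ finite_subset[OF arcs finite_arcs]]) (auto simp: out_arcs_def)
  have one: "\<exists>e. out_arcs T v = {e}" if "v \<in> verts G - {s}" for v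
    using T that by (auto simp: oriented_spanning_tree_def out_degree_def card_1_singleton_iff)
  have none: "out_arcs T s = {}"
    using T fin[of s] by (auto simp: oriented_spanning_tree_def out_degree_def)
  define c where "c = (\<lambda>v\<in>verts G - {s}. THE e. out_arcs T v = {e})"
  have c: "out_arcs T v = {c v}" if "v \<in> verts G - {s}" for v
    using one[OF that] that by (auto simp: c_def)
  show ?thesis
  proof (rule that)
    show "c \<in> PiE (verts G - {s}) (out_arcs G)"
    proof (rule PiE_I)
      fix v assume "v \<in> verts G - {s}"
      then show "c v \<in> out_arcs G v" using c[of v] arcs tail by (auto simp: out_arcs_def)
    qed (auto simp: c_def)
    have "arcs T = c ` (verts G - {s})"
    proof
      show "arcs T \<subseteq> c ` (verts G - {s})"
      proof
        fix e assume e: "e \<in> arcs T"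
        then have "e \<in> out_arcs T (tail G e)" using tail by (simp add: out_arcs_def)
        moreover from this have "tail G e \<in> verts G - {s}" using none e arcs by auto
        ultimately show "e \<in> c ` (verts G - {s})" using c by blast
      qed
      show "c ` (verts G - {s}) \<subseteq> arcs T" using c by (auto simp: out_arcs_def)
    qed
    then show "T = choice_graph G s c" by (simp add: choice_graph_def verts tail head)
  qed
qed

text \<open>\<open>choice_graph\<close> maps the choices counted by
  \<open>det_sink_matrix_eq_card\<close> bijectively onto the trees; the arc leaving each vertex
  recovers the choice.\<close>

theorem matrix_tree:
  assumes vs: "bij_betw vs {0..<n} (verts G)" and s: "s \<in> verts G"
  shows "det (mat n n (\<lambda>(i, j). sink_matrix G s (vs i) (vs j))) = int (spanning_tree_count G s)"
proof -
  let ?C = "{c \<in> PiE (verts G - {s}) (out_arcs G).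
    \<forall>v\<in>verts G. \<exists>m. ((\<lambda>v. head G (c v)) ^^ m) v = s}"
  have "inj_on (choice_graph G s) ?C"
  proof (rule inj_onI)
    fix c d assume "c \<in> ?C" "d \<in> ?C" and eq: "choice_graph G s c = choice_graph G s d"
    then have c: "c \<in> PiE (verts G - {s}) (out_arcs G)" and d: "d \<in> PiE (verts G - {s}) (out_arcs G)"
      by blast+
    show "c = d"
    proof (rule PiE_ext[OF c d])
      fix v assume "v \<in> verts G - {s}"
      then show "c v = d v"
        using out_arcs_choice_graph[OF s c, of v] out_arcs_choice_graph[OF s d, of v]
        unfolding eq by simp
    qed
  qed
  moreover have "choice_graph G s ` ?C = {T. oriented_spanning_tree G s T}"
  proof (intro equalityI subsetI)
    fix T assume "T \<in> {T. oriented_spanning_tree G s T}"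
    then have T: "oriented_spanning_tree G s T" by blast
    obtain c where c: "c \<in> PiE (verts G - {s}) (out_arcs G)" "T = choice_graph G s c"
      using oriented_spanning_tree_imp_choice_graph[OF s T] .
    have "c \<in> ?C"
      using c(1) T unfolding c(2) oriented_spanning_tree_choice_graph_iff[OF s c(1)] by simp
    then show "T \<in> choice_graph G s ` ?C" using c(2) by blast
  next
    fix T assume "T \<in> choice_graph G s ` ?C"
    then obtain c where c: "c \<in> PiE (verts G - {s}) (out_arcs G)" "T = choice_graph G s c"
      and reach: "\<forall>v\<in>verts G. \<exists>m. ((\<lambda>v. head G (c v)) ^^ m) v = s"
      by blast
    then show "T \<in> {T. oriented_spanning_tree G s T}"
      unfolding c(2) mem_Collect_eq oriented_spanning_tree_choice_graph_iff[OF s c(1)] by blast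
  qed
  ultimately have "card {T. oriented_spanning_tree G s T} = card ?C"
    using card_image by fastforce
  then have "card ?C = spanning_tree_count G s" by (simp only: spanning_tree_count_def)
  then show ?thesis by (simp only: det_sink_matrix_eq_card[OF vs s])
qed

end

section \<open>The period vector and the Pham index\<close>

context fin_digraph
begin

lemma laplacian_indicator:
  assumes "v \<in> verts G" "w \<in> verts G"
  shows "laplacian G (\<lambda>u. of_bool (u = w)) v = laplacian_matrix G v w"
  using assms by (simp add: laplacian_eq_matrix of_bool_def if_distrib cong: if_cong)

lemma sum_laplacian_matrix_column:
  assumes w: "w \<in> verts G"
  shows "(\<Sum>v\<in>verts G. laplacian_matrix G v w) = 0"
  using sum_laplacian[of "\<lambda>u. of_bool (u = w)"] w by (simp add: laplacian_indicator)

text \<open>Zeros propagate backwards: where \<open>f\<close> vanishes, the kernel equation says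
  that nonnegative values at the tails of the incoming arcs sum to zero.\<close>

lemma kernel_nonneg_eq_0:
  assumes sc: "strongly_connected G"
    and ker: "\<And>v. v \<in> verts G \<Longrightarrow> laplacian G f v = 0"
    and nonneg: "\<And>v. v \<in> verts G \<Longrightarrow> 0 \<le> f v"
    and v: "v \<in> verts G" "f v = 0" and w: "w \<in> verts G"
  shows "f w = 0"
proof -
  have pred: "f (tail G e) = 0" if e: "e \<in> arcs G" "f (head G e) = 0" for e
  proof -
    have "(\<Sum>e'\<in>in_arcs G (head G e). f (tail G e')) = 0"
      using ker[of "head G e"] e by (simp add: laplacian_apply)
    then have "\<forall>e'\<in>in_arcs G (head G e). f (tail G e') = 0"
      by (subst (asm) sum_nonneg_eq_0_iff) (auto intro: nonneg)
    then show ?thesis using e by auto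
  qed
  have "w \<rightarrow>\<^sup>*\<^bsub>G\<^esub> v" using sc v w by (simp add: strongly_connected_def)
  then obtain p where "awalk w p v" by (auto simp: reachable_awalk)
  then show ?thesis
  proof (induction p arbitrary: w)
    case Nil
    then show ?case using v by (simp add: awalk_Nil_iff)
  next
    case (Cons e p)
    then show ?case using pred[of e] by (simp add: awalk_Cons_iff)
  qed
qed

text \<open>By the triangle inequality the Laplacian of the absolute value is nonpositive
  everywhere; its values sum to zero, so all vanish.\<close>

lemma kernel_abs:
  assumes ker: "\<And>v. v \<in> verts G \<Longrightarrow> laplacian G f v = 0" and v: "v \<in> verts G"
  shows "laplacian G (\<lambda>v. \<bar>f v\<bar>) v = 0"
proof -
  have le: "laplacian G (\<lambda>v. \<bar>f v\<bar>) v \<le> 0" if "v \<in> verts G" for v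
  proof -
    have "int (out_degree G v) * f v = (\<Sum>e\<in>in_arcs G v. f (tail G e))"
      using ker[OF that] that by (simp add: laplacian_apply)
    then have "int (out_degree G v) * \<bar>f v\<bar> = \<bar>\<Sum>e\<in>in_arcs G v. f (tail G e)\<bar>"
      by (metis abs_mult abs_of_nat)
    also have "\<dots> \<le> (\<Sum>e\<in>in_arcs G v. \<bar>f (tail G e)\<bar>)" by (rule sum_abs)
    finally show ?thesis using that by (simp add: laplacian_apply)
  qed
  have "(\<Sum>v\<in>verts G. - laplacian G (\<lambda>v. \<bar>f v\<bar>) v) = 0"
    by (simp add: sum_negf sum_laplacian)
  then have "\<forall>v\<in>verts G. - laplacian G (\<lambda>v. \<bar>f v\<bar>) v = 0"
    by (subst (asm) sum_nonneg_eq_0_iff) (use le in auto)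
  then show ?thesis using v by simp
qed

text \<open>Take the absolute value of a nonzero kernel vector. It stays in the kernel, has no zeros
  by \<open>kernel_nonneg_eq_0\<close>, and is divided by the gcd of its values.\<close>

lemma ex_period_vector:
  assumes sc: "strongly_connected G"
  obtains \<pi> :: "'a \<Rightarrow> int" where "\<And>v. v \<in> verts G \<Longrightarrow> laplacian G \<pi> v = 0"
    "\<And>v. v \<in> verts G \<Longrightarrow> 0 < \<pi> v" "Gcd (\<pi> ` verts G) = 1"
proof -
  have ne: "verts G \<noteq> {}" using sc by (simp add: strongly_connected_def)
  obtain f where f: "\<And>v. v \<in> verts G \<Longrightarrow> (\<Sum>w\<in>verts G. laplacian_matrix G v w * f w) = 0"
    and f0: "\<exists>v\<in>verts G. f v \<noteq> 0"
    using ex_kernel_vector[OF finite_verts ne, of "laplacian_matrix G"] sum_laplacian_matrix_column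
    by blast
  have ker: "laplacian G (\<lambda>v. \<bar>f v\<bar>) v = 0" if "v \<in> verts G" for v
    by (rule kernel_abs[OF _ that]) (simp add: laplacian_eq_matrix f)
  have pos: "\<bar>f v\<bar> > 0" if "v \<in> verts G" for v
    using kernel_nonneg_eq_0[OF sc ker, of v] f0 that by force
  define g where "g = Gcd ((\<lambda>v. \<bar>f v\<bar>) ` verts G)"
  define \<pi> where "\<pi> v = \<bar>f v\<bar> div g" for v
  have g\<pi>: "g * \<pi> v = \<bar>f v\<bar>" if "v \<in> verts G" for v
    unfolding \<pi>_def g_def using that by (intro dvd_mult_div_cancel Gcd_dvd) blast
  obtain v0 where "v0 \<in> verts G" using ne by blast
  then have "g \<noteq> 0" using g\<pi> pos by force
  moreover have "g \<ge> 0" unfolding g_def by (rule Gcd_int_greater_eq_0)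
  ultimately have g: "g > 0" by simp
  show ?thesis
  proof (rule that)
    fix v assume v: "v \<in> verts G"
    show "0 < \<pi> v" using g\<pi>[OF v] pos[OF v] g by (metis zero_less_mult_pos)
    have "g * laplacian G \<pi> v = laplacian G (\<lambda>u. g * \<pi> u + 0 * \<pi> u) v"
      using laplacian_combination[OF v, of g \<pi> 0 \<pi>] by simp
    also have "\<dots> = laplacian G (\<lambda>u. \<bar>f u\<bar>) v"
      by (rule fun_cong[OF laplacian_cong]) (simp add: g\<pi>)
    finally show "laplacian G \<pi> v = 0" using ker[OF v] g by simp
  next
    have "(*) g ` \<pi> ` verts G = (\<lambda>v. \<bar>f v\<bar>) ` verts G" using g\<pi> by (auto simp: image_image)
    then have "Gcd ((*) g ` \<pi> ` verts G) = g" by (simp only: g_def)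
    then have "normalize (g * Gcd (\<pi> ` verts G)) = g" by (simp only: Gcd_mult)
    then show "Gcd (\<pi> ` verts G) = 1" using g by (simp add: abs_mult)
  qed
qed

section \<open>Tree counts and surjectivity of the Laplacian\<close>

lemma sum_sink_matrix:
  assumes s: "s \<in> verts G" and v: "v \<in> verts G"
  shows "(\<Sum>w\<in>verts G. sink_matrix G s v w * f w) =
    laplacian G f v + f s * (of_bool (v = s) - laplacian_matrix G v s)"
  using v unfolding laplacian_eq_matrix
  by (simp add: sum.remove[OF finite_verts s] sink_matrix_def algebra_simps)

text \<open>The adjugate solves the system of \<open>sink_matrix\<close>. Its solution vanishes at
  \<open>s\<close>, so replacing column \<open>s\<close> makes no difference.\<close>

lemma spanning_tree_count_mult_in_image:
  assumes s: "s \<in> verts G" and z: "(\<Sum>v\<in>verts G. z v) = 0"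
  shows "\<exists>f. \<forall>v\<in>verts G. laplacian G f v = int (spanning_tree_count G s) * z v"
proof -
  obtain vs where vs: "bij_betw vs {0..<card (verts G)} (verts G)"
    using ex_bij_betw_nat_finite[OF finite_verts] by blast
  obtain f where f: "\<And>v. v \<in> verts G \<Longrightarrow>
      (\<Sum>w\<in>verts G. sink_matrix G s v w * f w) = int (spanning_tree_count G s) * z v"
    using ex_solution_det_multiple[OF vs, of "sink_matrix G s" z] matrix_tree[OF vs s] by auto
  \<comment> \<open>On adding up all equations, the Laplacian and its column \<open>s\<close> sum to
    zero and only \<open>f s\<close> is left.\<close>
  have "f s = (\<Sum>v\<in>verts G. laplacian G f v + f s * (of_bool (v = s) - laplacian_matrix G v s))"
    using s by (simp add: sum.distrib sum_laplacian sum_subtractf sum_laplacian_matrix_column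
        flip: sum_distrib_left)
  also have "\<dots> = int (spanning_tree_count G s) * (\<Sum>v\<in>verts G. z v)"
    using f by (simp add: sum_sink_matrix[OF s] sum_distrib_left)
  finally have "f s = 0" using z by simp
  then have "laplacian G f v = int (spanning_tree_count G s) * z v" if "v \<in> verts G" for v
    using f[OF that] sum_sink_matrix[OF s that, of f] by simp
  then show ?thesis by blast
qed

text \<open>\<open>det_dvd_power\<close> applies with the constant \<open>\<pi> s\<close>:
  surjectivity reaches the difference of the unit vectors at \<open>u\<close> and \<open>s\<close>,
  and corrections by \<open>\<pi>\<close> and the indicator of \<open>s\<close> turn this into a
  solution for \<open>\<pi> s\<close> times the unit vector at \<open>u\<close>.\<close>

lemma spanning_tree_count_dvd_power:
  assumes surj: "\<And>z. (\<Sum>v\<in>verts G. z v) = 0 \<Longrightarrow> \<exists>f. \<forall>v\<in>verts G. laplacian G f v = z v"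
    and ker: "\<And>v. v \<in> verts G \<Longrightarrow> laplacian G \<pi> v = 0" and s: "s \<in> verts G"
  shows "\<exists>n. int (spanning_tree_count G s) dvd \<pi> s ^ n"
proof -
  obtain vs where vs: "bij_betw vs {0..<card (verts G)} (verts G)"
    using ex_bij_betw_nat_finite[OF finite_verts] by blast
  have "\<exists>f. \<forall>v\<in>verts G. (\<Sum>w\<in>verts G. sink_matrix G s v w * f w) = \<pi> s * of_bool (v = u)"
    if u: "u \<in> verts G" for u
  proof -
    have "(\<Sum>v\<in>verts G. of_bool (v = u) - of_bool (v = s) :: int) = 0"
      using u s by (simp add: sum_subtractf)
    then obtain h where h: "\<And>v. v \<in> verts G \<Longrightarrow>
        laplacian G h v = of_bool (v = u) - of_bool (v = s)" using surj by blast
    \<comment> \<open>\<open>h\<close> is scaled and corrected by a kernel vector so that the value at \<open>s\<close> becomes \<open>\<pi> s\<close>.\<close>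
    define f where "f v = 1 * (\<pi> s * h v + (- h s) * \<pi> v) + \<pi> s * of_bool (v = s)" for v
    have "laplacian G f v = \<pi> s * (of_bool (v = u) - of_bool (v = s) + laplacian_matrix G v s)"
      if v: "v \<in> verts G" for v
      unfolding f_def laplacian_combination[OF v] laplacian_indicator[OF v s] h[OF v] ker[OF v]
      by (simp add: algebra_simps)
    moreover have "f s = \<pi> s" by (simp add: f_def)
    ultimately have "(\<Sum>w\<in>verts G. sink_matrix G s v w * f w) = \<pi> s * of_bool (v = u)"
      if "v \<in> verts G" for v
      unfolding sum_sink_matrix[OF s that] using that by (simp add: algebra_simps)
    then show ?thesis by blast
  qed
  then have "int (spanning_tree_count G s) dvd \<pi> s ^ card (verts G)"
    using det_dvd_power[OF vs, of "sink_matrix G s" "\<pi> s"] matrix_tree[OF vs s] by simp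
  then show ?thesis by blast
qed

end

text \<open>Bezout's identity, one element at a time, starting from gcd 0 of the empty set.\<close>

lemma Gcd_finite_mem_subgroup:
  fixes I :: "int set"
  assumes "finite A" "A \<subseteq> I" "0 \<in> I" and comb: "\<And>a b x y. x \<in> I \<Longrightarrow> y \<in> I \<Longrightarrow> a * x + b * y \<in> I"
  shows "Gcd A \<in> I"
  using assms(1,2)
proof (induction A rule: finite_induct)
  case (insert x A)
  obtain a b where "a * x + b * Gcd A = gcd x (Gcd A)" using bezout_int by blast
  moreover have "a * x + b * Gcd A \<in> I" by (rule comb) (use insert in auto)
  ultimately show ?case by simp
qed (use assms(3) in simp)

context fin_digraph
begin

text \<open>The integers \<open>k\<close> for which \<open>k\<close> times \<open>z\<close> lies in
  the image form an ideal that contains all tree counts, hence their gcd.\<close>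

lemma laplacian_surj_if_Pham_index_1:
  assumes M: "Pham_index G = 1" and z: "(\<Sum>v\<in>verts G. z v) = 0"
  shows "\<exists>f. \<forall>v\<in>verts G. laplacian G f v = z v"
proof -
  define I where "I = {k. \<exists>f. \<forall>v\<in>verts G. laplacian G f v = k * z v}"
  have "Gcd ((\<lambda>s. int (spanning_tree_count G s)) ` verts G) \<in> I"
  proof (rule Gcd_finite_mem_subgroup)
    show "(\<lambda>s. int (spanning_tree_count G s)) ` verts G \<subseteq> I"
      using spanning_tree_count_mult_in_image[OF _ z] by (auto simp: I_def)
    show "0 \<in> I" by (auto simp: I_def laplacian_apply intro!: exI[of _ "\<lambda>_. 0"])
    fix a b x y assume "x \<in> I" "y \<in> I"
    then obtain f g where "\<forall>v\<in>verts G. laplacian G f v = x * z v"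
      "\<forall>v\<in>verts G. laplacian G g v = y * z v" by (auto simp: I_def)
    then have "\<forall>v\<in>verts G. laplacian G (\<lambda>u. a * f u + b * g u) v = (a * x + b * y) * z v"
      by (simp add: laplacian_combination algebra_simps)
    then show "a * x + b * y \<in> I" unfolding I_def by blast
  qed simp
  also have "Gcd ((\<lambda>s. int (spanning_tree_count G s)) ` verts G) = int (Pham_index G)"
    unfolding Pham_index_def by (simp add: image_image flip: Gcd_int_eq)
  finally show ?thesis using M by (auto simp: I_def)
qed

lemma Pham_index_1_if_laplacian_surj:
  assumes sc: "strongly_connected G"
    and surj: "\<And>z. (\<Sum>v\<in>verts G. z v) = 0 \<Longrightarrow> \<exists>f. \<forall>v\<in>verts G. laplacian G f v = z v"
  shows "Pham_index G = 1"
proof (rule ccontr)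
  assume "Pham_index G \<noteq> 1"
  \<comment> \<open>This also covers a Pham index of 0, which every prime divides.\<close>
  then obtain p where p: "prime p" "p dvd Pham_index G" using prime_factor_nat by blast
  obtain \<pi> where \<pi>: "\<And>v. v \<in> verts G \<Longrightarrow> laplacian G \<pi> v = 0" "Gcd (\<pi> ` verts G) = 1"
    using ex_period_vector[OF sc] by metis
  have "int p dvd \<pi> s" if s: "s \<in> verts G" for s
  proof -
    obtain n where n: "int (spanning_tree_count G s) dvd \<pi> s ^ n"
      using spanning_tree_count_dvd_power[OF surj \<pi>(1) s] by blast
    have "p dvd spanning_tree_count G s"
      using p(2) s unfolding Pham_index_def by (meson Gcd_dvd dvd_trans imageI)
    then have "int p dvd \<pi> s ^ n" using n by (meson dvd_trans int_dvd_int_iff)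
    then show ?thesis using p(1) by (meson prime_dvd_power prime_nat_int_transfer)
  qed
  then have "int p dvd Gcd (\<pi> ` verts G)" by (auto intro: Gcd_greatest)
  then show False using \<pi>(2) p(1) by (simp add: not_prime_unit)
qed

end

section \<open>Chip-firing\<close>

context fin_digraph
begin

lemma laplacian_restrict_indicator:
  "laplacian G (\<lambda>u\<in>verts G. if u = v then 1 else 0) = laplacian G (\<lambda>u. of_bool (u = v))"
  by (rule laplacian_cong) simp

lemma fire_apply:
  "w \<in> verts G \<Longrightarrow> fire G v \<sigma> w = \<sigma> w - laplacian G (\<lambda>u. of_bool (u = v)) w"
  by (simp add: fire_def laplacian_restrict_indicator)

lemma laplacian_add:
  "v \<in> verts G \<Longrightarrow> laplacian G (\<lambda>u. f u + g u) v = laplacian G f v + laplacian G g v"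
  using laplacian_combination[of v 1 f 1 g] by simp

text \<open>The witness counts how often each vertex fires before position \<open>i\<close>.\<close>

lemma legal_firing_sequence_eq_diff_laplacian:
  assumes "legal_firing_sequence G \<sigma>s" "i < length \<sigma>s"
  shows "\<exists>f. \<forall>w\<in>verts G. (\<sigma>s ! i) w = hd \<sigma>s w - laplacian G f w"
  using assms(2)
proof (induction i)
  case 0
  then show ?case
    by (intro exI[of _ "\<lambda>_. 0"]) (auto simp: hd_conv_nth laplacian_apply)
next
  case (Suc i)
  then obtain f where f: "\<forall>w\<in>verts G. (\<sigma>s ! i) w = hd \<sigma>s w - laplacian G f w" by auto
  obtain v where "\<sigma>s ! Suc i = fire G v (\<sigma>s ! i)"
    using assms(1) Suc.prems by (auto simp: legal_firing_sequence_def)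
  then have "\<forall>w\<in>verts G. (\<sigma>s ! Suc i) w = hd \<sigma>s w - laplacian G (\<lambda>u. f u + of_bool (u = v)) w"
    using f by (simp add: fire_apply laplacian_add)
  then show ?case by blast
qed

lemma stabilizes_imp_stable_equivalent:
  assumes "stabilizes G \<sigma>"
  obtains f where "stable G (\<lambda>v. \<sigma> v - laplacian G f v)"
proof -
  obtain \<sigma>s where \<sigma>s: "legal_firing_sequence G \<sigma>s" "hd \<sigma>s = \<sigma>" "stable G (last \<sigma>s)"
    using assms by (auto simp: stabilizes_def)
  then have "\<sigma>s \<noteq> []" by (simp add: legal_firing_sequence_def)
  then obtain f where "\<forall>w\<in>verts G. last \<sigma>s w = \<sigma> w - laplacian G f w"
    using legal_firing_sequence_eq_diff_laplacian[OF \<sigma>s(1), of "length \<sigma>s - 1"] \<sigma>s(2)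
    by (auto simp: last_conv_nth)
  then show ?thesis using \<sigma>s(3) that by (simp add: stable_def)
qed

lemma stabilizes_if_stable:
  assumes "\<sigma> \<in> int_vectors (verts G)" "stable G \<sigma>"
  shows "stabilizes G \<sigma>"
  unfolding stabilizes_def
  using assms by (intro exI[of _ "[\<sigma>]"]) (simp add: legal_firing_sequence_def)

lemma stabilizes_if_fire:
  assumes \<sigma>: "\<sigma> \<in> int_vectors (verts G)" and v: "active G \<sigma> v"
    and fire: "stabilizes G (fire G v \<sigma>)"
  shows "stabilizes G \<sigma>"
proof -
  obtain \<sigma>s where \<sigma>s: "legal_firing_sequence G \<sigma>s" "hd \<sigma>s = fire G v \<sigma>" "stable G (last \<sigma>s)"
    using fire by (auto simp: stabilizes_def)
  then have ne: "\<sigma>s \<noteq> []" by (simp add: legal_firing_sequence_def)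
  have "\<exists>v. active G ((\<sigma> # \<sigma>s) ! i) v \<and> (\<sigma> # \<sigma>s) ! Suc i = fire G v ((\<sigma> # \<sigma>s) ! i)"
    if i: "Suc i < length (\<sigma> # \<sigma>s)" for i
  proof (cases i)
    case 0
    then show ?thesis using v \<sigma>s(2) ne by (auto simp: hd_conv_nth)
  next
    case (Suc j)
    then show ?thesis using \<sigma>s(1) i by (simp add: legal_firing_sequence_def)
  qed
  then have "legal_firing_sequence G (\<sigma> # \<sigma>s)"
    using \<sigma> \<sigma>s(1) by (simp add: legal_firing_sequence_def)
  then show ?thesis
    unfolding stabilizes_def using \<sigma>s(3) ne by (intro exI[of _ "\<sigma> # \<sigma>s"]) simp
qed

text \<open>Induction on the total of \<open>f\<close>: an active vertex has a firing left in
  \<open>f\<close>, so it can be fired legally and removed from \<open>f\<close> once.\<close>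

lemma least_action_principle:
  assumes "\<sigma> \<in> int_vectors (verts G)" "\<And>v. v \<in> verts G \<Longrightarrow> 0 \<le> f v"
    and "stable G (\<lambda>v. \<sigma> v - laplacian G f v)"
  shows "stabilizes G \<sigma>"
  using assms
proof (induction "nat (\<Sum>v\<in>verts G. f v)" arbitrary: \<sigma> f rule: less_induct)
  case less
  show ?case
  proof (cases "stable G \<sigma>")
    case False
    then obtain v where v: "active G \<sigma> v" "v \<in> verts G"
      by (auto simp: stable_def active_def not_less)
    \<comment> \<open>A vertex that \<open>f\<close> does not fire can only gain chips, so it would
      still be active in the stable configuration.\<close>
    have "f v \<noteq> 0"
    proof
      assume "f v = 0"
      then have "laplacian G f v \<le> 0"
        using v less.prems(2) by (auto simp: laplacian_apply intro!: sum_nonneg)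
      then show False using v less.prems(3) by (force simp: stable_def active_def)
    qed
    then have fv: "f v \<ge> 1" using less.prems(2)[OF v(2)] by simp
    define g where "g = (\<lambda>u. 1 * f u + (- 1) * of_bool (u = v))"
    have sum_g: "(\<Sum>u\<in>verts G. g u) = (\<Sum>u\<in>verts G. f u) - 1"
      using v(2) by (simp add: g_def sum_subtractf)
    have g: "0 \<le> g u" if "u \<in> verts G" for u
      using fv less.prems(2)[OF that] by (auto simp: g_def)
    have "0 \<le> (\<Sum>u\<in>verts G. g u)" by (rule sum_nonneg) (rule g)
    then have lt: "nat (\<Sum>u\<in>verts G. g u) < nat (\<Sum>u\<in>verts G. f u)" using sum_g by simp
    have "laplacian G g w = laplacian G f w - laplacian G (\<lambda>u. of_bool (u = v)) w"
      if "w \<in> verts G" for w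
      unfolding g_def laplacian_combination[OF that] by simp
    then have "stable G (\<lambda>w. fire G v \<sigma> w - laplacian G g w)"
      using less.prems(3) by (simp add: stable_def fire_apply)
    moreover have "fire G v \<sigma> \<in> int_vectors (verts G)" by (simp add: fire_def int_vectors_def)
    ultimately show ?thesis using less.hyps[OF lt _ g] stabilizes_if_fire less.prems(1) v(1) by blast
  qed (use less.prems stabilizes_if_stable in blast)
qed

section \<open>Chip numbers and stabilization\<close>

lemma sum_stable_le:
  assumes "stable G \<tau>"
  shows "(\<Sum>v\<in>verts G. \<tau> v) \<le> int (card (arcs G)) - int (card (verts G))"
proof -
  have "(\<Sum>v\<in>verts G. \<tau> v) \<le> (\<Sum>v\<in>verts G. int (out_degree G v) - 1)"
    using assms by (intro sum_mono) (force simp: stable_def)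
  then show ?thesis by (simp add: sum_subtractf sum_out_degree)
qed

lemma stabilizes_imp_sum_le:
  assumes "stabilizes G \<sigma>"
  shows "(\<Sum>v\<in>verts G. \<sigma> v) \<le> int (card (arcs G)) - int (card (verts G))"
proof -
  obtain f where "stable G (\<lambda>v. \<sigma> v - laplacian G f v)"
    using stabilizes_imp_stable_equivalent[OF assms] .
  then show ?thesis using sum_stable_le by (fastforce simp: sum_subtractf sum_laplacian)
qed

lemma stabilizes_if_sum_le:
  assumes surj: "\<And>z. (\<Sum>v\<in>verts G. z v) = 0 \<Longrightarrow> \<exists>f. \<forall>v\<in>verts G. laplacian G f v = z v"
    and \<pi>: "\<And>v. v \<in> verts G \<Longrightarrow> laplacian G \<pi> v = 0" "\<And>v. v \<in> verts G \<Longrightarrow> 0 < \<pi> v"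
    and ne: "verts G \<noteq> {}" and \<sigma>: "\<sigma> \<in> int_vectors (verts G)"
    and le: "(\<Sum>v\<in>verts G. \<sigma> v) \<le> int (card (arcs G)) - int (card (verts G))"
  shows "stabilizes G \<sigma>"
proof -
  obtain s where s: "s \<in> verts G" using ne by blast
  define m where "m = int (card (arcs G)) - int (card (verts G)) - (\<Sum>v\<in>verts G. \<sigma> v)"
  \<comment> \<open>The target is the largest stable configuration, lowered at \<open>s\<close> by
    the \<open>m\<close> missing chips so that its total is that of \<open>\<sigma>\<close>.\<close>
  define \<tau> where "\<tau> v = int (out_degree G v) - 1 - m * of_bool (v = s)" for v
  have "(\<Sum>v\<in>verts G. \<tau> v) = int (card (arcs G)) - int (card (verts G)) - m"
    using s by (simp add: \<tau>_def sum_subtractf sum_out_degree flip: sum_distrib_left)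
  then have "(\<Sum>v\<in>verts G. \<sigma> v - \<tau> v) = 0" by (simp add: sum_subtractf m_def)
  then obtain f where f: "\<forall>v\<in>verts G. laplacian G f v = \<sigma> v - \<tau> v" using surj by blast
  \<comment> \<open>As \<open>\<pi>\<close> is at least 1 and \<open>k\<close> bounds the absolute
    values of \<open>f\<close>, adding \<open>k\<close> times \<open>\<pi>\<close> makes the firing
    vector nonnegative without changing its Laplacian.\<close>
  define k where "k = (\<Sum>v\<in>verts G. \<bar>f v\<bar>)"
  define g where "g v = 1 * f v + k * \<pi> v" for v
  have Lg: "laplacian G g v = \<sigma> v - \<tau> v" if "v \<in> verts G" for v
    unfolding g_def laplacian_combination[OF that] using f \<pi>(1) that by simp
  show ?thesis
  proof (rule least_action_principle[OF \<sigma>])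
    fix v assume v: "v \<in> verts G"
    have "\<bar>f v\<bar> \<le> k" unfolding k_def by (rule member_le_sum[OF v]) auto
    moreover have "k * 1 \<le> k * \<pi> v"
      using \<pi>(2)[OF v] by (intro mult_left_mono) (auto simp: k_def sum_nonneg)
    ultimately show "0 \<le> g v" by (simp add: g_def)
  next
    have "m \<ge> 0" using le by (simp add: m_def)
    then have "\<tau> v < int (out_degree G v)" for v by (simp add: \<tau>_def)
    then show "stable G (\<lambda>v. \<sigma> v - laplacian G g v)" by (simp add: stable_def Lg)
  qed
qed

text \<open>
  With \<open>#E - #V\<close> chips the only stable configuration has \<open>d\<^sub>v - 1\<close> chips at each \<open>v\<close>, so
  all configurations with that many chips are equivalent modulo the image of the Laplacian.
\<close>

lemma laplacian_surj_if_stabilizes: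
  assumes stab: "\<And>\<sigma>. \<sigma> \<in> int_vectors (verts G) \<Longrightarrow>
      (\<Sum>v\<in>verts G. \<sigma> v) \<le> int (card (arcs G)) - int (card (verts G)) \<Longrightarrow> stabilizes G \<sigma>"
    and z: "(\<Sum>v\<in>verts G. z v) = 0"
  shows "\<exists>f. \<forall>v\<in>verts G. laplacian G f v = z v"
proof -
  define \<sigma> where "\<sigma> = (\<lambda>v\<in>verts G. z v + (int (out_degree G v) - 1))"
  have "(\<Sum>v\<in>verts G. \<sigma> v) = int (card (arcs G)) - int (card (verts G))"
    by (simp add: \<sigma>_def sum.distrib z sum_subtractf sum_out_degree)
  moreover have "\<sigma> \<in> int_vectors (verts G)" by (simp add: \<sigma>_def int_vectors_def)
  ultimately have "stabilizes G \<sigma>" using stab by simp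
  then obtain f where f: "stable G (\<lambda>v. \<sigma> v - laplacian G f v)"
    by (rule stabilizes_imp_stable_equivalent)
  \<comment> \<open>A stable value is at most the outdegree minus 1, which is
    \<open>\<sigma> v - z v\<close>; equality at every vertex then follows from the total.\<close>
  then have nonneg: "0 \<le> laplacian G f v - z v" if "v \<in> verts G" for v
    using that by (force simp: stable_def \<sigma>_def)
  have "(\<Sum>v\<in>verts G. laplacian G f v - z v) = 0" by (simp add: sum_subtractf sum_laplacian z)
  then have "\<forall>v\<in>verts G. laplacian G f v - z v = 0"
    by (subst (asm) sum_nonneg_eq_0_iff) (use nonneg in auto)
  then show ?thesis by auto
qed

end

section \<open>Sandpile groups\<close>

context fin_digraph
begin

lemma laplacian_eq_reduced_laplacian:
  assumes s: "s \<in> verts G" and v: "v \<in> verts G - {s}"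
  shows "laplacian G f v = reduced_laplacian G s f v - f s * sink_vector G s v"
  using v s unfolding laplacian_eq_matrix
  by (simp add: sum.remove[OF finite_verts s] reduced_laplacian_def sink_vector_def laplacian_matrix_def)

lemma reduced_laplacian_cong:
  assumes "\<And>v. v \<in> verts G - {s} \<Longrightarrow> f v = g v"
  shows "reduced_laplacian G s f = reduced_laplacian G s g"
  unfolding reduced_laplacian_def using assms by (intro restrict_ext sum.cong) auto

lemma reduced_laplacian_in_image: "reduced_laplacian G s f \<in> reduced_laplacian_image G s"
proof -
  have "reduced_laplacian G s f = reduced_laplacian G s (restrict f (verts G - {s}))"
    by (rule reduced_laplacian_cong) simp
  moreover have "restrict f (verts G - {s}) \<in> int_vectors (verts G - {s})"
    by (simp add: int_vectors_def)
  ultimately show ?thesis unfolding reduced_laplacian_image_def by blast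
qed

lemma eq_restrict_iff:
  assumes "x \<in> int_vectors S"
  shows "x = restrict y S \<longleftrightarrow> (\<forall>v\<in>S. x v = y v)"
  using assms by (auto simp: int_vectors_def PiE_def extensional_def fun_eq_iff)

lemma range_eq_image_iff:
  assumes "range h \<subseteq> f ` Z"
  shows "range h = f ` Z \<longleftrightarrow> (\<forall>x\<in>Z. \<exists>k. f x = h k)"
  using assms by (auto simp: image_subset_iff image_iff set_eq_iff)

lemma update_carrier_eq_iff: "K\<lparr>carrier := A\<rparr> = K \<longleftrightarrow> A = carrier K"
  by (metis partial_object.select_convs(1) partial_object.surjective partial_object.update_convs(1))

lemma generate_integer_group_1: "generate integer_group {1} = UNIV"
  using group.generate_pow[OF group_integer_group, of 1] by auto

text \<open>This removes the quotient group: multiples of the generator are classes of multiples of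
  \<open>sink_vector\<close>, and equal classes differ by an element of the image.\<close>

lemma cyclic_generator_sandpile_group_iff:
  "cyclic_generator (sandpile_group G s) (sandpile_class G s (sink_vector G s)) \<longleftrightarrow>
    (\<forall>x. \<exists>k f. \<forall>v\<in>verts G - {s}. x v = reduced_laplacian G s f v + k * sink_vector G s v)"
proof -
  let ?S = "verts G - {s}"
  let ?Z = "int_vector_group ?S" and ?H = "reduced_laplacian_image G s"
  let ?K = "sandpile_group G s" and ?b = "sink_vector G s"
  let ?kb = "\<lambda>k. \<lambda>v\<in>?S. k * ?b v"
  interpret Z: comm_group ?Z by (rule comm_group_int_vector_group)
  interpret K: comm_group ?K by (rule comm_group_sandpile_group)
  interpret L: group_hom ?Z ?Z "reduced_laplacian G s" by (rule group_hom_reduced_laplacian)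
  have H: "subgroup ?H ?Z"
    using L.img_is_subgroup by (simp add: reduced_laplacian_image_def)
  interpret H: normal ?H ?Z by (rule Z.subgroup_imp_normal[OF H])
  have carrier: "carrier ?K = sandpile_class G s ` int_vectors ?S"
    by (auto simp: sandpile_group_def sandpile_class_def FactGroup_def RCOSETS_def)
  have kb: "?kb k \<in> int_vectors ?S" for k by (simp add: int_vectors_def)
  \<comment> \<open>Since 1 generates \<open>integer_group\<close>, the image of this homomorphism
    is the subgroup generated by the class of \<open>?b\<close>.\<close>
  have hom: "group_hom integer_group ?K (\<lambda>k. sandpile_class G s (?kb k))"
  proof (intro group_hom.intro group_hom_axioms.intro homI)
    fix k l :: int
    have "?kb (k + l) = ?kb k \<otimes>\<^bsub>?Z\<^esub> ?kb l" by (auto simp: distrib_right)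
    then show "sandpile_class G s (?kb (k \<otimes>\<^bsub>integer_group\<^esub> l)) =
        sandpile_class G s (?kb k) \<otimes>\<^bsub>?K\<^esub> sandpile_class G s (?kb l)"
      using hom_mult[OF H.r_coset_hom_Mod, of "?kb k" "?kb l"] kb
      by (simp add: sandpile_class_def sandpile_group_def)
  qed (use kb in \<open>auto simp: carrier K.is_group\<close>)
  have "?kb 1 = ?b" by (auto simp: sink_vector_def)
  then have "generate ?K {sandpile_class G s ?b} = range (\<lambda>k. sandpile_class G s (?kb k))"
    using group_hom.generate_img[OF hom, of "{1}"] by (simp add: generate_integer_group_1)
  moreover have b: "sandpile_class G s ?b \<in> carrier ?K"
    by (rule sandpile_class_sink_vector_in_carrier)
  \<comment> \<open>\<open>subgroup_generated\<close> changes only the carrier, so equality of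
    groups reduces to equality of carriers.\<close>
  ultimately have gen: "cyclic_generator ?K (sandpile_class G s ?b) \<longleftrightarrow>
      range (\<lambda>k. sandpile_class G s (?kb k)) = carrier ?K"
    by (simp add: cyclic_generator_def subgroup_generated_def update_carrier_eq_iff)
  have mult: "reduced_laplacian G s f \<otimes>\<^bsub>?Z\<^esub> ?kb k =
      (\<lambda>v\<in>?S. reduced_laplacian G s f v + k * ?b v)" for f k
    by (auto simp: fun_eq_iff)
  have class_eq: "sandpile_class G s x = sandpile_class G s (?kb k) \<longleftrightarrow>
      (\<exists>f. \<forall>v\<in>?S. x v = reduced_laplacian G s f v + k * ?b v)"
    if x: "x \<in> int_vectors ?S" for x k
  proof -
    have "sandpile_class G s x = sandpile_class G s (?kb k) \<longleftrightarrow> x \<in> ?H #>\<^bsub>?Z\<^esub> ?kb k"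
      using Z.repr_independence[OF _ _ H, of x "?kb k"] Z.rcos_self[OF _ H, of x] x kb
      by (auto simp: sandpile_class_def)
    also have "\<dots> \<longleftrightarrow> (\<exists>f. x = (\<lambda>v\<in>?S. reduced_laplacian G s f v + k * ?b v))"
    proof
      assume "x \<in> ?H #>\<^bsub>?Z\<^esub> ?kb k"
      then obtain f where "x = reduced_laplacian G s f \<otimes>\<^bsub>?Z\<^esub> ?kb k"
        by (auto simp: r_coset_def reduced_laplacian_image_def)
      then have "x = (\<lambda>v\<in>?S. reduced_laplacian G s f v + k * ?b v)" unfolding mult .
      then show "\<exists>f. x = (\<lambda>v\<in>?S. reduced_laplacian G s f v + k * ?b v)" by (rule exI[of _ f])
    next
      assume "\<exists>f. x = (\<lambda>v\<in>?S. reduced_laplacian G s f v + k * ?b v)"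
      then obtain f where "x = (\<lambda>v\<in>?S. reduced_laplacian G s f v + k * ?b v)" by blast
      then have "x = reduced_laplacian G s f \<otimes>\<^bsub>?Z\<^esub> ?kb k" unfolding mult .
      then show "x \<in> ?H #>\<^bsub>?Z\<^esub> ?kb k"
        unfolding r_coset_def
        by (intro UN_I[OF reduced_laplacian_in_image[of s f]]) (simp only: singleton_iff)
    qed
    also have "\<dots> \<longleftrightarrow> (\<exists>f. \<forall>v\<in>?S. x v = reduced_laplacian G s f v + k * ?b v)"
      by (simp only: eq_restrict_iff[OF x])
    finally show ?thesis .
  qed
  have "range (\<lambda>k. sandpile_class G s (?kb k)) = carrier ?K \<longleftrightarrow>
      (\<forall>x\<in>int_vectors ?S. \<exists>k. sandpile_class G s x = sandpile_class G s (?kb k))"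
    unfolding carrier by (intro range_eq_image_iff image_subsetI imageI kb)
  also have "\<dots> \<longleftrightarrow> (\<forall>x\<in>int_vectors ?S. \<exists>k f. \<forall>v\<in>?S.
      x v = reduced_laplacian G s f v + k * ?b v)"
    by (simp add: class_eq)
  also have "\<dots> \<longleftrightarrow> (\<forall>x. \<exists>k f. \<forall>v\<in>?S. x v = reduced_laplacian G s f v + k * ?b v)"
  proof (intro iffI allI ballI)
    fix x :: "'a \<Rightarrow> int"
    assume all: "\<forall>x\<in>int_vectors ?S. \<exists>k f. \<forall>v\<in>?S. x v = reduced_laplacian G s f v + k * ?b v"
    have "restrict x ?S \<in> int_vectors ?S" by (simp add: int_vectors_def)
    then obtain k f where "\<forall>v\<in>?S. restrict x ?S v = reduced_laplacian G s f v + k * ?b v"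
      using all by blast
    then have "\<forall>v\<in>?S. x v = reduced_laplacian G s f v + k * ?b v" by simp
    then show "\<exists>k f. \<forall>v\<in>?S. x v = reduced_laplacian G s f v + k * ?b v" by blast
  qed blast
  finally show ?thesis using gen by simp
qed

text \<open>
  The coefficient of the generator corresponds to minus the value at the sink, and the equation
  at the sink follows from the others because all values sum to zero.
\<close>

lemma cyclic_generator_sandpile_group_iff_laplacian_surj:
  assumes s: "s \<in> verts G"
  shows "cyclic_generator (sandpile_group G s) (sandpile_class G s (sink_vector G s)) \<longleftrightarrow>
    (\<forall>z. (\<Sum>v\<in>verts G. z v) = 0 \<longrightarrow> (\<exists>f. \<forall>v\<in>verts G. laplacian G f v = z v))"
  unfolding cyclic_generator_sandpile_group_iff
proof (intro iffI allI impI)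
  fix z :: "'a \<Rightarrow> int"
  assume "\<forall>x. \<exists>k f. \<forall>v\<in>verts G - {s}. x v = reduced_laplacian G s f v + k * sink_vector G s v"
    and z: "(\<Sum>v\<in>verts G. z v) = 0"
  then obtain k f where f:
    "\<forall>v\<in>verts G - {s}. z v = reduced_laplacian G s f v + k * sink_vector G s v" by blast
  \<comment> \<open>The coefficient \<open>k\<close> is stored as the value \<open>- k\<close> at
    the sink, which \<open>reduced_laplacian\<close> does not see.\<close>
  have "reduced_laplacian G s (f(s := - k)) = reduced_laplacian G s f"
    by (rule reduced_laplacian_cong) simp
  then have off: "laplacian G (f(s := - k)) v = z v" if "v \<in> verts G - {s}" for v
    using f that by (simp add: laplacian_eq_reduced_laplacian[OF s that])
  have "laplacian G (f(s := - k)) s = z s"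
    using sum_laplacian[of "f(s := - k)"] z off by (simp add: sum.remove[OF finite_verts s])
  then have "\<forall>v\<in>verts G. laplacian G (f(s := - k)) v = z v" using off by blast
  then show "\<exists>f. \<forall>v\<in>verts G. laplacian G f v = z v" by blast
next
  fix x :: "'a \<Rightarrow> int"
  assume surj: "\<forall>z. (\<Sum>v\<in>verts G. z v) = 0 \<longrightarrow> (\<exists>f. \<forall>v\<in>verts G. laplacian G f v = z v)"
  \<comment> \<open>The value at the sink is chosen to make the total zero.\<close>
  let ?z = "x(s := - (\<Sum>v\<in>verts G - {s}. x v))"
  have "(\<Sum>v\<in>verts G. ?z v) = 0" by (simp add: sum.remove[OF finite_verts s])
  then obtain f where f: "\<forall>v\<in>verts G. laplacian G f v = ?z v" using surj by blast
  have "x v = reduced_laplacian G s f v + (- f s) * sink_vector G s v"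
    if "v \<in> verts G - {s}" for v
    using bspec[OF f, of v] that laplacian_eq_reduced_laplacian[OF s that, of f] by simp
  then show "\<exists>k f. \<forall>v\<in>verts G - {s}. x v = reduced_laplacian G s f v + k * sink_vector G s v"
    by blast
qed

end

section \<open>The equivalences\<close>

theorem theorem1p2:
  fixes G :: "('a, 'b) pre_digraph"
  assumes "fin_digraph G" and "strongly_connected G"
  shows
    "(laplacian G ` int_vectors (verts G) = int_vectors_0 (verts G)
        \<longleftrightarrow> Pham_index G = 1) \<and>
     (laplacian G ` int_vectors (verts G) = int_vectors_0 (verts G)
        \<longleftrightarrow> (\<forall>\<sigma>\<in>int_vectors (verts G).
              stabilizes G \<sigma> \<longleftrightarrow>
              (\<Sum>v\<in>verts G. \<sigma> v) \<le> int (card (arcs G)) - int (card (verts G)))) \<and>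
     (laplacian G ` int_vectors (verts G) = int_vectors_0 (verts G)
        \<longleftrightarrow> (\<forall>s\<in>verts G.
              cyclic_generator (sandpile_group G s) (sandpile_class G s (sink_vector G s)))) \<and>
     (laplacian G ` int_vectors (verts G) = int_vectors_0 (verts G)
        \<longleftrightarrow> (\<exists>s\<in>verts G.
              cyclic_generator (sandpile_group G s) (sandpile_class G s (sink_vector G s))))"
proof -
  interpret fin_digraph G by fact
  have ne: "verts G \<noteq> {}" using assms(2) by (simp add: strongly_connected_def)
  \<comment> \<open>Every condition is compared with this one. The condition at each single sink is
    equivalent to it, so the universal and existential versions agree because \<open>verts G\<close>
    is nonempty.\<close>
  define surj where "surj \<longleftrightarrow>
    (\<forall>z. (\<Sum>v\<in>verts G. z v) = 0 \<longrightarrow> (\<exists>f. \<forall>v\<in>verts G. laplacian G f v = z v))"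
  have image: "laplacian G ` int_vectors (verts G) = int_vectors_0 (verts G) \<longleftrightarrow> surj"
    unfolding surj_def by (rule laplacian_image_eq_iff)
  have pham: "surj \<longleftrightarrow> Pham_index G = 1"
    using laplacian_surj_if_Pham_index_1 Pham_index_1_if_laplacian_surj[OF assms(2)]
    unfolding surj_def by blast
  have chips: "surj \<longleftrightarrow> (\<forall>\<sigma>\<in>int_vectors (verts G). stabilizes G \<sigma> \<longleftrightarrow>
      (\<Sum>v\<in>verts G. \<sigma> v) \<le> int (card (arcs G)) - int (card (verts G)))"
  proof
    assume surj
    obtain \<pi> where "\<And>v. v \<in> verts G \<Longrightarrow> laplacian G \<pi> v = 0" "\<And>v. v \<in> verts G \<Longrightarrow> 0 < \<pi> v"
      using ex_period_vector[OF assms(2)] by metis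
    then show "\<forall>\<sigma>\<in>int_vectors (verts G). stabilizes G \<sigma> \<longleftrightarrow>
        (\<Sum>v\<in>verts G. \<sigma> v) \<le> int (card (arcs G)) - int (card (verts G))"
      using stabilizes_if_sum_le[of \<pi>] stabilizes_imp_sum_le ne \<open>surj\<close> unfolding surj_def by blast
  next
    assume "\<forall>\<sigma>\<in>int_vectors (verts G). stabilizes G \<sigma> \<longleftrightarrow>
        (\<Sum>v\<in>verts G. \<sigma> v) \<le> int (card (arcs G)) - int (card (verts G))"
    then show surj using laplacian_surj_if_stabilizes unfolding surj_def by blast
  qed
  have sandpile: "cyclic_generator (sandpile_group G s) (sandpile_class G s (sink_vector G s)) \<longleftrightarrow> surj"
    if "s \<in> verts G" for s
    unfolding surj_def by (rule cyclic_generator_sandpile_group_iff_laplacian_surj[OF that])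
  show ?thesis unfolding image using pham chips sandpile ne by blast
qed

end
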